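(* Let $p\in(0,1)$ be a constant and let $G=G_p\in\mathcal{G}_{n,p}$ be a random graph. Let $dist(G)$ be the distance matrix of $G$, with $(i,j)$-entry $D(i,j)$. Then $$\mathscr{E}(dist(G))=\Big(\frac{8}{3\pi}\sqrt{p(1-p)}+o(1)\Big)n^{3/2}\quad\text{a.s.}$$
   Context: $D(i,j)$ is the distance between vertices $i$ and $j$ in $G$. The energy of a real symmetric matrix $M$ with eigenvalues $\lambda_1,\dots,\lambda_n$ is $\mathscr{E}(M)=\sum_{i=1}^n|\lambda_i|$. $\mathcal{G}_{n,p}$ is the Erdős–Rényi random graph model on $n$ vertices, each edge chosen independently with probability $p$. "a.s." means with probability tending to $1$ as $n\to\infty$; the $o(1)$ term is bounded in absolute value by a deterministic sequence tending to $0$ with probability tending to $1$. (With probability tending to $1$ the graph is connected with diameter $2$, so the convention for distances in disconnected graphs is irrelevant.) *)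

theory Defs
  imports
    "HOL-Probability.Probability"
    "HOL-Probability.Product_PMF"
    "Jordan_Normal_Form.Char_Poly"
    "Graph_Theory.Graph_Theory"
begin

(* A simple graph is a pair_graph of the AFP library: a finite, loopfree, symmetric digraph
   without parallel arcs, where each undirected edge {i,j} is stored as both arcs (i,j), (j,i). *)
definition edge_graph :: "nat \<Rightarrow> nat set set \<Rightarrow> nat pair_pre_digraph" where
  "edge_graph n E =
     \<lparr> pverts = {..<n}, parcs = {(i, j). i < n \<and> j < n \<and> i \<noteq> j \<and> {i, j} \<in> E} \<rparr>"

definition possible_edges :: "nat \<Rightarrow> nat set set" where
  "possible_edges n = {e. e \<subseteq> {..<n} \<and> card e = 2}"

(* Each 2-subset of the vertices tosses one coin (so the two arcs of an edge occur together),
   independently of the other 2-subsets. *)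
definition gnp :: "nat \<Rightarrow> real \<Rightarrow> nat pair_pre_digraph pmf" where
  "gnp n p = map_pmf (\<lambda>f. edge_graph n {e \<in> possible_edges n. f e})
     (Pi_pmf (possible_edges n) False (\<lambda>_. bernoulli_pmf p))"

(* Least number of edges of a walk from i to j, via the library's least walk cost with all
   weights 1. Convention: if j is not reachable from i, that cost is infinite and
   real_of_ereal turns it into 0. *)
definition graph_dist :: "'a pair_pre_digraph \<Rightarrow> 'a \<Rightarrow> 'a \<Rightarrow> real" where
  "graph_dist G i j = real_of_ereal (wf_digraph.\<mu> (with_proj G) (\<lambda>_. 1) i j)"

definition dist_matrix :: "nat \<Rightarrow> nat pair_pre_digraph \<Rightarrow> real mat" where
  "dist_matrix n G = mat n n (\<lambda>(i, j). graph_dist G i j)"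

(* proots counts every root of the characteristic polynomial with its multiplicity. Only real
   roots are seen, which for a real symmetric matrix are all of its eigenvalues. *)
definition energy :: "real mat \<Rightarrow> real" where
  "energy M = (\<Sum>x\<in>#proots (char_poly M). \<bar>x\<bar>)"

lemma pair_graph_edge_graph: "pair_graph (edge_graph n E)"
proof
  show "finite (pverts (edge_graph n E))"
    by (simp add: edge_graph_def)
  show "finite (parcs (edge_graph n E))"
    by (rule finite_subset[of _ "{..<n} \<times> {..<n}"]) (auto simp: edge_graph_def)
  show "symmetric (with_proj (edge_graph n E))"
    by (auto simp: edge_graph_def symmetric_def sym_def insert_commute)
qed (auto simp: edge_graph_def)

end

theory Submission
  imports Defs "HOL-Real_Asymp.Real_Asymp"
begin

text \<open>
  Write \<open>A\<close> for the adjacency matrix of \<open>G\<close>, \<open>J\<close> for the all-ones matrix and \<open>W\<close> for the symmetric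
  matrix with zero diagonal and off-diagonal entries \<open>(A i j - p) / sqrt n\<close>. With probability tending
  to one any two vertices have a common neighbour. Then every distance between distinct vertices is
  \<open>2 - A i j\<close>, so that the distance matrix is \<open>(2 - p) (J - I) - sqrt n W\<close>. The energy is the trace
  norm, and the trace norms of \<open>J\<close> and \<open>I\<close> are both \<open>n\<close>, so the energy differs from
  \<open>sqrt n\<close> times the energy of \<open>W\<close> by at most \<open>4 n\<close>, which is \<open>o(n powr (3/2))\<close>
  (\<open>energy_dist_matrix_coin_graph\<close>). It remains to show that the mean absolute eigenvalue of \<open>W\<close>
  tends to the first absolute moment \<open>8 sqrt v / (3 pi)\<close> of the semicircle law of variance
  \<open>v = p (1 - p)\<close> (\<open>mean_abs_eigenvalue_limit\<close>).

  The absolute value is an integral of resolvents along the imaginary axis,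
  \<open>pi / 2 * \<bar>x\<bar> = (\<integral>t>0. x^2 / (x^2 + t^2))\<close>, and the average of \<open>x^2 / (x^2 + t^2)\<close> over the
  eigenvalues \<open>x\<close> of \<open>W\<close> is \<open>1 - t * Im (s (\<i> t))\<close>, where \<open>s z\<close> is the normalised trace of the
  resolvent \<open>R = (W - z I)^(-1)\<close>. It therefore suffices to find the limit of \<open>s (\<i> t)\<close> for each
  \<open>t > 0\<close>. The average is at most \<open>2 / (1 + t^2)\<close>, so dominated convergence carries the limit
  through the integral.

  To find that limit, start from \<open>W R = I + z R\<close>. A coin \<open>x\<close> with success probability
  \<open>p\<close> satisfies the exact integration by parts
  \<open>E ((x - p) F x) = p (1 - p) (F 1 - F 0)\<close>. Toggling one edge changes \<open>W\<close> in two entries, and the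
  resolvent identity turns \<open>F 1 - F 0\<close> for an entry \<open>F\<close> of \<open>R\<close> into products of two entries of \<open>R\<close>.
  Summing over all entries gives \<open>1 + z E s + v E (s^2) = O(1 / sqrt n)\<close>
  (\<open>wigner_entry_expectation\<close>). Toggling an edge changes \<open>s\<close> by \<open>O(n powr (- 3 / 2))\<close>, so by the
  Efron--Stein inequality \<open>s\<close> has variance \<open>O(1 / n)\<close> and \<open>E (s^2)\<close> may be replaced by \<open>(E s)^2\<close>.
  Hence \<open>E s\<close> almost solves the quadratic equation of the semicircle law. The two roots of that
  equation lie in opposite half planes, and \<open>E s\<close> lies in the upper one, so it is close to the
  root there (\<open>semicircle_equation_stable\<close>).
\<close>

section \<open>Orthonormal eigenbases of real symmetric matrices\<close>

text \<open>
  The dimension \<open>n\<close> grows, so vectors and matrices are functions on \<open>nat\<close> of which only the values at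
  indices below \<open>n\<close> matter.
\<close>
definition dot :: "nat \<Rightarrow> (nat \<Rightarrow> real) \<Rightarrow> (nat \<Rightarrow> real) \<Rightarrow> real" where
  "dot n x y = (\<Sum>i<n. x i * y i)"

definition apply_mat :: "nat \<Rightarrow> (nat \<Rightarrow> nat \<Rightarrow> real) \<Rightarrow> (nat \<Rightarrow> real) \<Rightarrow> nat \<Rightarrow> real" where
  "apply_mat n A x i = (\<Sum>j<n. A i j * x j)"

lemma dot_commute: "dot n x y = dot n y x"
  by (simp add: dot_def mult.commute)

lemma dot_add_right: "dot n x (\<lambda>i. y i + z i) = dot n x y + dot n x z"
  by (simp add: dot_def algebra_simps sum.distrib)

lemma dot_scale_right: "dot n x (\<lambda>i. c * y i) = c * dot n x y"
  by (simp add: dot_def algebra_simps sum_distrib_left)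

lemma dot_add_left: "dot n (\<lambda>i. y i + z i) x = dot n y x + dot n z x"
  by (simp add: dot_def algebra_simps sum.distrib)

lemma dot_scale_left: "dot n (\<lambda>i. c * y i) x = c * dot n y x"
  by (simp add: dot_def algebra_simps sum_distrib_left)

lemmas dot_linear = dot_add_right dot_scale_right dot_add_left dot_scale_left

lemma dot_cong: "(\<And>i. i < n \<Longrightarrow> x i = x' i) \<Longrightarrow> (\<And>i. i < n \<Longrightarrow> y i = y' i) \<Longrightarrow> dot n x y = dot n x' y'"
  by (simp add: dot_def)

lemma dot_self_nonneg: "dot n x x \<ge> 0"
  by (simp add: dot_def sum_nonneg)

lemma dot_self_eq_0: "dot n x x = 0 \<Longrightarrow> i < n \<Longrightarrow> x i = 0"
  by (simp add: dot_def sum_nonneg_eq_0_iff)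

lemma apply_mat_add: "apply_mat n A (\<lambda>i. y i + z i) = (\<lambda>i. apply_mat n A y i + apply_mat n A z i)"
  by (simp add: apply_mat_def algebra_simps sum.distrib fun_eq_iff)

lemma apply_mat_scale: "apply_mat n A (\<lambda>i. c * y i) = (\<lambda>i. c * apply_mat n A y i)"
  by (simp add: apply_mat_def algebra_simps sum_distrib_left fun_eq_iff)

lemma apply_mat_cong: "(\<And>j. j < n \<Longrightarrow> x j = y j) \<Longrightarrow> apply_mat n A x i = apply_mat n A y i"
  by (simp add: apply_mat_def)

lemma dot_apply_mat_sym:
  assumes "\<And>i j. i < n \<Longrightarrow> j < n \<Longrightarrow> A i j = A j i"
  shows "dot n x (apply_mat n A y) = dot n (apply_mat n A x) y"
proof -
  have "dot n x (apply_mat n A y) = (\<Sum>i<n. \<Sum>j<n. x i * (A i j * y j))"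
    by (simp add: dot_def apply_mat_def sum_distrib_left)
  also have "\<dots> = (\<Sum>j<n. \<Sum>i<n. x i * (A i j * y j))"
    by (rule sum.swap)
  also have "\<dots> = dot n (apply_mat n A x) y"
    unfolding dot_def apply_mat_def sum_distrib_right
    by (intro sum.cong refl) (auto simp: assms)
  finally show ?thesis .
qed

lemma continuous_on_component [continuous_intros]:
  "continuous_on S (\<lambda>x::nat \<Rightarrow> real. x i)"
  by (rule continuous_on_subset[OF continuous_on_product_coordinates]) auto

text \<open>
  Fixing the coordinates from \<open>n\<close> on to zero makes Tychonoff's theorem a substitute for the
  compactness of balls in \<open>n\<close>-dimensional space.
\<close>
lemma compact_box:
  "compact {x :: nat \<Rightarrow> real. \<forall>i. x i \<in> (if i < n then {-1..1} else {0})}"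
proof -
  have "{x :: nat \<Rightarrow> real. \<forall>i. x i \<in> (if i < n then {-1..1} else {0})}
      = PiE UNIV (\<lambda>i. if i < n then {-1..1} else {0})"
    by (auto simp: PiE_def Pi_def)
  moreover have "compactin (product_topology (\<lambda>_. euclidean) UNIV)
      (PiE UNIV (\<lambda>i::nat. if i < n then {-1..1} else {0::real}))"
    by (subst compactin_PiE) auto
  ultimately show ?thesis
    by (simp add: euclidean_product_topology)
qed

text \<open>
  The projections \<open>w j\<close> of the standard basis vectors to the orthogonal complement have squared
  lengths summing to the trace \<open>n - k > 0\<close> of that projection, so one of them does not vanish.
\<close>
lemma unit_vector_orthogonal_exists:
  assumes orth: "\<And>l m. l < k \<Longrightarrow> m < k \<Longrightarrow> dot n (u l) (u m) = of_bool (l = m)"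
    and "k < n"
  shows "\<exists>x. dot n x x = 1 \<and> (\<forall>l<k. dot n (u l) x = 0)"
proof -
  define w where "w j i = of_bool (i = j) - (\<Sum>l<k. u l j * u l i)" for j i
  have uw: "dot n (u m) (w j) = 0" if "m < k" "j < n" for m j
  proof -
    have "dot n (u m) (w j) = (\<Sum>i<n. u m i * of_bool (i = j)) - (\<Sum>i<n. \<Sum>l<k. u m i * (u l j * u l i))"
      by (simp add: dot_def w_def right_diff_distrib sum_subtractf sum_distrib_left)
    also have "(\<Sum>i<n. \<Sum>l<k. u m i * (u l j * u l i)) = (\<Sum>l<k. u l j * dot n (u m) (u l))"
      by (subst sum.swap) (simp add: dot_def sum_distrib_left algebra_simps)
    also have "\<dots> = (\<Sum>l<k. if l = m then u l j else 0)"
      using that by (intro sum.cong) (auto simp: orth)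
    also have "\<dots> = u m j"
      using that by simp
    finally show ?thesis
      using that by (simp add: of_bool_def if_distrib sum.delta cong: if_cong)
  qed
  have ww: "dot n (w j) (w j) = 1 - (\<Sum>l<k. (u l j)^2)" if "j < n" for j
  proof -
    have "dot n (w j) (w j) = (\<Sum>i<n. of_bool (i = j) * w j i) - (\<Sum>i<n. \<Sum>l<k. u l j * u l i * w j i)"
      unfolding dot_def
      by (subst (1) w_def) (simp only: left_diff_distrib sum_subtractf sum_distrib_right)
    also have "(\<Sum>i<n. \<Sum>l<k. u l j * u l i * w j i) = (\<Sum>l<k. u l j * dot n (u l) (w j))"
      by (subst sum.swap) (simp add: dot_def sum_distrib_left algebra_simps)
    also have "\<dots> = 0" using that by (simp add: uw)
    also have "(\<Sum>i<n. of_bool (i = j) * w j i) = (\<Sum>i<n. if i = j then w j i else 0)"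
      by (intro sum.cong) auto
    also have "\<dots> = w j j" using that by simp
    also have "w j j = 1 - (\<Sum>l<k. (u l j)^2)" by (simp add: w_def power2_eq_square)
    finally show ?thesis by simp
  qed
  have "(\<Sum>j<n. dot n (w j) (w j)) = real n - (\<Sum>j<n. \<Sum>l<k. (u l j)^2)"
    by (simp add: ww sum_subtractf)
  also have "(\<Sum>j<n. \<Sum>l<k. (u l j)^2) = (\<Sum>l<k. dot n (u l) (u l))"
    by (subst sum.swap) (simp add: dot_def power2_eq_square)
  also have "\<dots> = real k" by (simp add: orth)
  finally have "(\<Sum>j<n. dot n (w j) (w j)) > 0" using \<open>k < n\<close> by simp
  then obtain j where j: "j < n" "dot n (w j) (w j) \<noteq> 0"
    by (metis (no_types, lifting) lessThan_iff less_irrefl sum.neutral)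
  define N where "N = dot n (w j) (w j)"
  have N: "N > 0" using j dot_self_nonneg[of n "w j"] by (simp add: N_def)
  define x where "x = (\<lambda>i. (1 / sqrt N) * w j i)"
  have "dot n x x = 1"
    unfolding x_def dot_linear using N by (simp add: N_def[symmetric] field_simps)
  moreover have "dot n (u l) x = 0" if "l < k" for l
    unfolding x_def dot_linear using uw that j by simp
  ultimately show ?thesis by blast
qed

text \<open>
  A maximiser \<open>x\<close> of the quadratic form over the unit vectors orthogonal to the given eigenvectors is
  an eigenvector. Indeed the residue \<open>r = A x - c x\<close> with \<open>c\<close> the maximum stays in the complement,
  because \<open>A\<close> is symmetric, and moving from \<open>x\<close> in the direction of \<open>r\<close> would raise the Rayleigh
  quotient to first order if \<open>r\<close> were not zero.
\<close>
lemma eigenvector_in_complement: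
  assumes sym: "\<And>i j. i < n \<Longrightarrow> j < n \<Longrightarrow> A i j = A j i"
    and eig: "\<And>l i. l < k \<Longrightarrow> i < n \<Longrightarrow> apply_mat n A (u l) i = lam l * u l i"
    and orth: "\<And>l m. l < k \<Longrightarrow> m < k \<Longrightarrow> dot n (u l) (u m) = of_bool (l = m)"
    and "k < n"
  shows "\<exists>x c. dot n x x = 1 \<and> (\<forall>l<k. dot n (u l) x = 0) \<and> (\<forall>i<n. apply_mat n A x i = c * x i)"
proof -
  define q where "q x = dot n x (apply_mat n A x)" for x
  define S where "S = {x. \<forall>i. x i \<in> (if i < n then {-1..1} else {0})}
      \<inter> ({x. dot n x x = 1} \<inter> (\<Inter>l<k. {x. dot n (u l) x = 0}))"
  have cont: "continuous_on UNIV q"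
    unfolding q_def dot_def apply_mat_def by (intro continuous_intros)
  have "compact S" unfolding S_def
    by (intro compact_Int_closed compact_box closed_Int closed_INT ballI closed_Collect_eq)
       (auto simp: dot_def intro!: continuous_intros)
  have restrict_S: "(\<lambda>i. if i < n then x i else 0) \<in> S"
    if "dot n x x = 1" "\<forall>l<k. dot n (u l) x = 0" for x
  proof -
    have "(x i)^2 \<le> 1" if "i < n" for i
    proof -
      have "(x i)^2 \<le> (\<Sum>i<n. (x i)^2)" using that by (intro member_le_sum) auto
      thus ?thesis using \<open>dot n x x = 1\<close> by (simp add: dot_def power2_eq_square)
    qed
    hence "\<bar>x i\<bar> \<le> 1" if "i < n" for i using that by (simp add: abs_square_le_1)
    hence "x i \<le> 1 \<and> - x i \<le> 1" if "i < n" for i using that abs_le_iff by blast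
    moreover have "dot n (\<lambda>i. if i < n then x i else 0) (\<lambda>i. if i < n then x i else 0) = 1"
      using that(1) by (subst dot_cong[of _ _ x _ x]) auto
    moreover have "dot n (u l) (\<lambda>i. if i < n then x i else 0) = 0" if "l < k" for l
      using \<open>\<forall>l<k. dot n (u l) x = 0\<close> that by (subst dot_cong[of _ _ "u l" _ x]) auto
    ultimately show ?thesis by (force simp: S_def)
  qed
  obtain x0 where "dot n x0 x0 = 1" "\<forall>l<k. dot n (u l) x0 = 0"
    using unit_vector_orthogonal_exists[OF orth \<open>k < n\<close>] by auto
  hence "S \<noteq> {}" using restrict_S by blast
  then obtain x where x: "x \<in> S" and xmax: "\<And>y. y \<in> S \<Longrightarrow> q y \<le> q x"
    using continuous_attains_sup[OF \<open>compact S\<close> _ continuous_on_subset[OF cont]] by auto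
  have xx: "dot n x x = 1" and ux: "\<And>l. l < k \<Longrightarrow> dot n (u l) x = 0"
    using x by (auto simp: S_def)
  define c where "c = q x"
  have bound: "q y \<le> c * dot n y y" if y: "\<forall>l<k. dot n (u l) y = 0" for y
  proof (cases "dot n y y = 0")
    case True
    hence "y i = 0" if "i < n" for i using dot_self_eq_0 that by blast
    hence "q y = 0" by (simp add: q_def dot_def)
    thus ?thesis using True by simp
  next
    case False
    define N where "N = dot n y y"
    have N: "N > 0" using False dot_self_nonneg[of n y] by (simp add: N_def)
    define z where "z = (\<lambda>i. (1 / sqrt N) * y i)"
    have "dot n z z = 1" unfolding z_def dot_linear using N by (simp add: N_def[symmetric] field_simps)
    moreover have "\<forall>l<k. dot n (u l) z = 0" unfolding z_def dot_linear using y by simp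
    ultimately have "q (\<lambda>i. if i < n then z i else 0) \<le> c"
      unfolding c_def by (intro xmax restrict_S)
    also have "q (\<lambda>i. if i < n then z i else 0) = q z"
      unfolding q_def by (intro dot_cong apply_mat_cong) auto
    also have "q z = q y / N"
      unfolding q_def z_def apply_mat_scale dot_linear using N by (simp add: field_simps)
    finally show ?thesis using N by (simp add: field_simps N_def)
  qed
  define r where "r i = apply_mat n A x i + (- c) * x i" for i
  have ur: "dot n (u l) r = 0" if "l < k" for l
  proof -
    have "dot n (u l) r = dot n (u l) (apply_mat n A x) + (- c) * dot n (u l) x"
      unfolding r_def dot_linear ..
    also have "dot n (u l) (apply_mat n A x) = dot n (apply_mat n A (u l)) x"
      by (rule dot_apply_mat_sym) (rule sym)
    also have "\<dots> = dot n (\<lambda>i. lam l * u l i) x"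
      using that by (intro dot_cong) (auto simp: eig)
    finally show ?thesis using that by (simp add: dot_linear ux)
  qed
  have "dot n r r = 0"
  proof (rule ccontr)
    assume "dot n r r \<noteq> 0"
    define R where "R = dot n r r"
    have R: "R > 0" using \<open>dot n r r \<noteq> 0\<close> dot_self_nonneg[of n r] by (simp add: R_def)
    define K where "K = c * dot n r r - q r"
    have "K \<ge> 0" using bound[of r] ur by (simp add: K_def)
    have rA: "dot n r (apply_mat n A x) = R + c * dot n r x"
    proof -
      have "R = dot n r (\<lambda>i. apply_mat n A x i + (- c) * x i)" by (simp add: R_def r_def[abs_def])
      thus ?thesis unfolding dot_linear by simp
    qed
    \<comment> \<open>The second order loss \<open>s^2 K\<close> stays below the first order gain \<open>2 s R\<close> for this step size.\<close>
    define s where "s = R / (K + 1)"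
    have "s > 0" using R \<open>K \<ge> 0\<close> by (simp add: s_def)
    define y where "y = (\<lambda>i. x i + s * r i)"
    have "q y \<le> c * dot n y y"
      by (rule bound) (simp add: y_def dot_linear ux ur)
    moreover have "q y = c + 2 * s * dot n r (apply_mat n A x) + s^2 * q r"
      using dot_apply_mat_sym[of n A x r, OF sym]
      unfolding q_def y_def apply_mat_add apply_mat_scale dot_linear c_def
      by (simp add: algebra_simps power2_eq_square dot_commute[of n "apply_mat n A x" r])
    moreover have "dot n y y = 1 + 2 * s * dot n r x + s^2 * R"
      unfolding y_def dot_linear R_def by (simp add: algebra_simps power2_eq_square xx dot_commute[of n x r])
    ultimately have "2 * s * R \<le> s^2 * K"
      unfolding rA K_def R_def by (simp add: algebra_simps)
    hence "2 * R \<le> s * K" using \<open>s > 0\<close> by (simp add: power2_eq_square)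
    moreover have "s * K \<le> s * (K + 1)" using \<open>s > 0\<close> by simp
    moreover have "s * (K + 1) = R" using \<open>K \<ge> 0\<close> by (simp add: s_def)
    ultimately show False using R by simp
  qed
  hence "apply_mat n A x i = c * x i" if "i < n" for i
    using dot_self_eq_0[of n r i] that by (simp add: r_def)
  thus ?thesis using xx ux by blast
qed

lemma orthonormal_eigenvectors_exist:
  assumes sym: "\<And>i j. i < n \<Longrightarrow> j < n \<Longrightarrow> A i j = A j i"
    and "k \<le> n"
  shows "\<exists>u lam. (\<forall>l<k. \<forall>i<n. apply_mat n A (u l) i = lam l * u l i)
    \<and> (\<forall>l<k. \<forall>m<k. dot n (u l) (u m) = of_bool (l = m))"
  using \<open>k \<le> n\<close>
proof (induction k)
  case 0
  show ?case by simp
next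
  case (Suc k)
  then obtain u lam where *: "\<forall>l<k. \<forall>i<n. apply_mat n A (u l) i = lam l * u l i"
    "\<forall>l<k. \<forall>m<k. dot n (u l) (u m) = of_bool (l = m)" by auto
  have "\<exists>x c. dot n x x = 1 \<and> (\<forall>l<k. dot n (u l) x = 0) \<and> (\<forall>i<n. apply_mat n A x i = c * x i)"
    using * Suc.prems by (intro eigenvector_in_complement[OF sym]) auto
  then obtain x c where x: "dot n x x = 1" "\<forall>l<k. dot n (u l) x = 0" "\<forall>i<n. apply_mat n A x i = c * x i"
    by blast
  have xu: "\<forall>l<k. dot n x (u l) = 0" using x(2) by (metis dot_commute)
  have "\<forall>l<Suc k. \<forall>i<n. apply_mat n A ((u(k := x)) l) i = (lam(k := c)) l * (u(k := x)) l i"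
    using * x by (auto simp: less_Suc_eq)
  moreover have "\<forall>l<Suc k. \<forall>m<Suc k. dot n ((u(k := x)) l) ((u(k := x)) m) = of_bool (l = m)"
    using * x xu by (auto simp: less_Suc_eq)
  ultimately show ?case by blast
qed

text \<open>
  Column \<open>k\<close> of \<open>U\<close> is the eigenvector for \<open>lam k\<close>. Rows and columns are both required to be
  orthonormal, since both forms of Parseval's identity are used below.
\<close>
definition eigendecomp ::
  "nat \<Rightarrow> (nat \<Rightarrow> nat \<Rightarrow> real) \<Rightarrow> (nat \<Rightarrow> real) \<Rightarrow> (nat \<Rightarrow> nat \<Rightarrow> real) \<Rightarrow> bool" where
  "eigendecomp n A lam U \<longleftrightarrow>
     (\<forall>k<n. \<forall>l<n. (\<Sum>i<n. U i k * U i l) = of_bool (k = l)) \<and>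
     (\<forall>i<n. \<forall>j<n. (\<Sum>k<n. U i k * U j k) = of_bool (i = j)) \<and>
     (\<forall>i<n. \<forall>j<n. A i j = (\<Sum>k<n. lam k * (U i k * U j k)))"

lemma eigendecompD:
  assumes "eigendecomp n A lam U"
  shows "k < n \<Longrightarrow> l < n \<Longrightarrow> (\<Sum>i<n. U i k * U i l) = of_bool (k = l)"
    and "i < n \<Longrightarrow> j < n \<Longrightarrow> (\<Sum>k<n. U i k * U j k) = of_bool (i = j)"
    and "i < n \<Longrightarrow> j < n \<Longrightarrow> A i j = (\<Sum>k<n. lam k * (U i k * U j k))"
  using assms by (auto simp: eigendecomp_def)

theorem eigendecomp_exists:
  assumes sym: "\<And>i j. i < n \<Longrightarrow> j < n \<Longrightarrow> A i j = A j i"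
  shows "\<exists>lam U. eigendecomp n A lam U"
proof -
  obtain u lam where *: "\<forall>l<n. \<forall>i<n. apply_mat n A (u l) i = lam l * u l i"
      "\<forall>l<n. \<forall>m<n. dot n (u l) (u m) = of_bool (l = m)"
    using orthonormal_eigenvectors_exist[of n A n, OF sym] by blast
  have eig: "apply_mat n A (u l) i = lam l * u l i" if "l < n" "i < n" for l i
    using * that by blast
  have orth: "dot n (u l) (u m) = of_bool (l = m)" if "l < n" "m < n" for l m
    using * that by blast
  define P where "P = mat n n (\<lambda>(l, i). u l i)"
  define Q where "Q = mat n n (\<lambda>(i, l). u l i)"
  have carr: "P \<in> carrier_mat n n" "Q \<in> carrier_mat n n" by (auto simp: P_def Q_def)
  have "P * Q = 1\<^sub>m n"
    by (rule eq_matI) (auto simp: P_def Q_def scalar_prod_def orth[unfolded dot_def] atLeast0LessThan)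
  hence QP: "Q * P = 1\<^sub>m n"
    using mat_mult_left_right_inverse carr by blast
  have compl: "(\<Sum>l<n. u l i * u l j) = of_bool (i = j)" if "i < n" "j < n" for i j
  proof -
    have "(\<Sum>l<n. u l i * u l j) = (Q * P) $$ (i, j)"
      using that by (simp add: P_def Q_def scalar_prod_def atLeast0LessThan)
    also have "\<dots> = of_bool (i = j)"
      unfolding QP using that by simp
    finally show ?thesis .
  qed
  have "A i j = (\<Sum>k<n. lam k * (u k i * u k j))" if "i < n" "j < n" for i j
  proof -
    have "A i j = (\<Sum>m<n. A i m * of_bool (m = j))"
      using that by (simp add: of_bool_def if_distrib sum.delta cong: if_cong)
    also have "\<dots> = (\<Sum>m<n. \<Sum>k<n. A i m * u k m * u k j)"
      using that by (intro sum.cong refl) (simp add: compl[symmetric] sum_distrib_left algebra_simps)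
    also have "\<dots> = (\<Sum>k<n. apply_mat n A (u k) i * u k j)"
      by (subst sum.swap) (simp add: apply_mat_def sum_distrib_right)
    finally show ?thesis using that by (simp add: eig algebra_simps)
  qed
  hence "eigendecomp n A lam (\<lambda>i k. u k i)"
    unfolding eigendecomp_def using compl orth by (auto simp: dot_def)
  thus ?thesis by blast
qed

text \<open>
  Being similar to a real diagonal matrix, \<open>A\<close> has a characteristic polynomial that splits over the
  reals, so the real roots counted by the energy are all \<open>n\<close> eigenvalues.
\<close>
lemma energy_eq_sum_abs:
  assumes "eigendecomp n A lam U"
  shows "energy (mat n n (\<lambda>(i, j). A i j)) = (\<Sum>k<n. \<bar>lam k\<bar>)"
proof -
  note e = eigendecompD[OF assms]
  define P where "P = mat n n (\<lambda>(i, k). U i k)"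
  define Q where "Q = mat n n (\<lambda>(k, i). U i k)"
  define L where "L = mat n n (\<lambda>(k, l). if k = l then lam k else 0)"
  define M where "M = mat n n (\<lambda>(i, j). A i j)"
  have carr: "P \<in> carrier_mat n n" "Q \<in> carrier_mat n n" "L \<in> carrier_mat n n" "M \<in> carrier_mat n n"
    by (auto simp: P_def Q_def L_def M_def)
  have PQ: "P * Q = 1\<^sub>m n"
    by (rule eq_matI) (auto simp: P_def Q_def scalar_prod_def e(2) atLeast0LessThan)
  have QP: "Q * P = 1\<^sub>m n"
    by (rule eq_matI) (auto simp: P_def Q_def scalar_prod_def e(1) atLeast0LessThan)
  have "P * L = mat n n (\<lambda>(i, k). U i k * lam k)"
    by (rule eq_matI) (auto simp: P_def L_def scalar_prod_def if_distrib sum.delta atLeast0LessThan cong: if_cong)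
  hence "P * L * Q = mat n n (\<lambda>(i, k). U i k * lam k) * Q" by simp
  also have "\<dots> = M"
    by (rule eq_matI) (auto simp: Q_def M_def scalar_prod_def e(3) atLeast0LessThan algebra_simps)
  finally have "M = P * L * Q" by simp
  hence "similar_mat M L"
    unfolding similar_mat_def similar_mat_wit_def Let_def using carr PQ QP
    by (intro exI[of _ P] exI[of _ Q]) auto
  hence "char_poly M = char_poly L" by (rule char_poly_similar)
  also have "\<dots> = (\<Prod>a\<leftarrow>diag_mat L. [:- a, 1:])"
    by (rule char_poly_upper_triangular[OF carr(3)]) (auto simp: L_def)
  also have "diag_mat L = map lam [0..<n]"
    by (auto simp: diag_mat_def L_def)
  finally have "char_poly M = (\<Prod>k\<leftarrow>[0..<n]. [:- lam k, 1:])" by (simp add: o_def)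
  also have "\<dots> = (\<Prod>k<n. [:- lam k, 1:])"
    using prod.distinct_set_conv_list[of "[0..<n]" "\<lambda>k. [:- lam k, 1:]"]
    by (simp add: lessThan_atLeast0)
  finally have "char_poly M = (\<Prod>k<n. [:- lam k, 1:])" .
  hence "proots (char_poly M) = (\<Sum>k<n. {#lam k#})"
    by (simp add: proots_prod)
  moreover have "(\<Sum>x\<in>#(\<Sum>k\<in>K. {#lam k#}). \<bar>x\<bar>) = (\<Sum>k\<in>K. \<bar>lam k\<bar>)" if "finite K" for K
    using that by induction auto
  ultimately show ?thesis by (simp add: energy_def M_def)
qed

section \<open>Comparison of trace norms\<close>

lemma parseval:
  fixes Q :: "nat \<Rightarrow> nat \<Rightarrow> real"
  assumes "\<And>i j. i < n \<Longrightarrow> j < n \<Longrightarrow> (\<Sum>k<n. Q i k * Q j k) = of_bool (i = j)"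
  shows "(\<Sum>k<n. (\<Sum>i<n. Q i k * x i)^2) = (\<Sum>i<n. (x i)^2)"
proof -
  have "(\<Sum>k<n. (\<Sum>i<n. Q i k * x i)^2) = (\<Sum>k<n. \<Sum>i<n. \<Sum>j<n. x i * x j * (Q i k * Q j k))"
    by (simp add: power2_eq_square sum_product algebra_simps)
  also have "\<dots> = (\<Sum>i<n. \<Sum>j<n. \<Sum>k<n. x i * x j * (Q i k * Q j k))"
    by (subst sum.swap) (intro sum.cong refl sum.swap)
  also have "\<dots> = (\<Sum>i<n. \<Sum>j<n. if i = j then x i * x j else 0)"
    by (intro sum.cong refl) (simp add: sum_distrib_left[symmetric] assms)
  also have "\<dots> = (\<Sum>i<n. (x i)^2)"
    by (simp add: power2_eq_square)
  finally show ?thesis .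
qed

lemma quadratic_form_eigendecomp:
  assumes "eigendecomp n A lam U"
  shows "(\<Sum>i<n. \<Sum>j<n. x i * A i j * x j) = (\<Sum>l<n. lam l * (\<Sum>i<n. U i l * x i)^2)"
proof -
  have "(\<Sum>i<n. \<Sum>j<n. x i * A i j * x j) =
      (\<Sum>i<n. \<Sum>j<n. \<Sum>l<n. lam l * ((U i l * x i) * (U j l * x j)))"
    by (intro sum.cong refl)
       (simp add: eigendecompD(3)[OF assms] sum_distrib_left sum_distrib_right algebra_simps)
  also have "\<dots> = (\<Sum>i<n. \<Sum>l<n. \<Sum>j<n. lam l * ((U i l * x i) * (U j l * x j)))"
    by (intro sum.cong refl sum.swap)
  also have "\<dots> = (\<Sum>l<n. \<Sum>i<n. \<Sum>j<n. lam l * ((U i l * x i) * (U j l * x j)))"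
    by (rule sum.swap)
  also have "\<dots> = (\<Sum>l<n. lam l * (\<Sum>i<n. U i l * x i)^2)"
    unfolding power2_eq_square sum_product by (simp add: sum_distrib_left)
  finally show ?thesis .
qed

lemma eigenvalue_eq_quadratic_form:
  assumes "eigendecomp n A lam U" "k < n"
  shows "lam k = (\<Sum>i<n. \<Sum>j<n. U i k * A i j * U j k)"
proof -
  have "(\<Sum>i<n. \<Sum>j<n. U i k * A i j * U j k) = (\<Sum>l<n. lam l * (\<Sum>i<n. U i l * U i k)^2)"
    by (rule quadratic_form_eigendecomp[OF assms(1)])
  also have "\<dots> = (\<Sum>l<n. if l = k then lam l else 0)"
    using assms(2) by (intro sum.cong refl) (simp add: eigendecompD(1)[OF assms(1)])
  finally show ?thesis using assms(2) by simp
qed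

text \<open>
  This is the triangle inequality for the trace norm of \<open>A = a J + b I + s B\<close>, with \<open>J\<close> the all-ones
  matrix. Each eigenvalue of \<open>A\<close> is the value of the quadratic form at its eigenvector; in the
  eigenbasis of \<open>B\<close> the form of \<open>B\<close> is a combination of the \<open>mu l\<close> with weights that sum to one over
  either basis, and the form of \<open>J\<close> sums to \<open>n\<close> over any orthonormal basis.
\<close>
lemma sum_abs_eigenvalues_le:
  assumes A: "eigendecomp n A lam U" and B: "eigendecomp n B mu V"
    and AB: "\<And>i j. i < n \<Longrightarrow> j < n \<Longrightarrow> A i j = a + b * of_bool (i = j) + s * B i j"
  shows "(\<Sum>k<n. \<bar>lam k\<bar>) \<le> (\<bar>a\<bar> + \<bar>b\<bar>) * n + \<bar>s\<bar> * (\<Sum>l<n. \<bar>mu l\<bar>)"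
proof -
  have "\<bar>lam k\<bar> \<le> \<bar>a\<bar> * (\<Sum>i<n. U i k * 1)^2 + \<bar>b\<bar> + \<bar>s\<bar> * (\<Sum>l<n. \<bar>mu l\<bar> * (\<Sum>i<n. U i k * V i l)^2)"
    if k: "k < n" for k
  proof -
    have "lam k = (\<Sum>i<n. \<Sum>j<n. U i k * A i j * U j k)"
      by (rule eigenvalue_eq_quadratic_form[OF A k])
    also have "\<dots> = (\<Sum>i<n. \<Sum>j<n. a * (U i k * U j k) + b * (if i = j then U i k * U j k else 0)
        + s * (U i k * B i j * U j k))"
      by (intro sum.cong refl) (simp add: AB algebra_simps)
    also have "\<dots> = a * (\<Sum>i<n. U i k * 1)^2 + b * (\<Sum>i<n. U i k * U i k)
        + s * (\<Sum>i<n. \<Sum>j<n. U i k * B i j * U j k)"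
      by (simp add: sum.distrib sum_distrib_left[symmetric] power2_eq_square sum_product)
    also have "(\<Sum>i<n. U i k * U i k) = 1"
      using eigendecompD(1)[OF A k k] by simp
    also have "(\<Sum>i<n. \<Sum>j<n. U i k * B i j * U j k) = (\<Sum>l<n. mu l * (\<Sum>i<n. U i k * V i l)^2)"
      by (subst quadratic_form_eigendecomp[OF B]) (simp add: mult.commute)
    finally have "lam k = a * (\<Sum>i<n. U i k * 1)^2 + b * 1 + s * (\<Sum>l<n. mu l * (\<Sum>i<n. U i k * V i l)^2)" .
    hence "\<bar>lam k\<bar> \<le> \<bar>a * (\<Sum>i<n. U i k * 1)^2\<bar> + \<bar>b\<bar> + \<bar>s * (\<Sum>l<n. mu l * (\<Sum>i<n. U i k * V i l)^2)\<bar>"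
      by linarith
    also have "\<bar>s * (\<Sum>l<n. mu l * (\<Sum>i<n. U i k * V i l)^2)\<bar>
        \<le> \<bar>s\<bar> * (\<Sum>l<n. \<bar>mu l\<bar> * (\<Sum>i<n. U i k * V i l)^2)"
      unfolding abs_mult by (intro mult_left_mono order_trans[OF sum_abs] sum_mono) (auto simp: abs_mult)
    finally show ?thesis by (simp add: abs_mult)
  qed
  hence "(\<Sum>k<n. \<bar>lam k\<bar>) \<le> (\<Sum>k<n. \<bar>a\<bar> * (\<Sum>i<n. U i k * 1)^2 + \<bar>b\<bar>
      + \<bar>s\<bar> * (\<Sum>l<n. \<bar>mu l\<bar> * (\<Sum>i<n. U i k * V i l)^2))"
    by (intro sum_mono) auto
  also have "\<dots> = \<bar>a\<bar> * (\<Sum>k<n. (\<Sum>i<n. U i k * 1)^2) + \<bar>b\<bar> * n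
      + \<bar>s\<bar> * (\<Sum>k<n. \<Sum>l<n. \<bar>mu l\<bar> * (\<Sum>i<n. U i k * V i l)^2)"
    by (simp add: sum.distrib sum_distrib_left)
  also have "(\<Sum>k<n. (\<Sum>i<n. U i k * 1)^2) = n"
    by (subst parseval) (auto simp: eigendecompD(2)[OF A])
  also have "(\<Sum>k<n. \<Sum>l<n. \<bar>mu l\<bar> * (\<Sum>i<n. U i k * V i l)^2)
      = (\<Sum>l<n. \<bar>mu l\<bar> * (\<Sum>k<n. (\<Sum>i<n. U i k * V i l)^2))"
    by (subst sum.swap) (simp add: sum_distrib_left)
  also have "\<dots> = (\<Sum>l<n. \<bar>mu l\<bar> * (\<Sum>i<n. V i l * V i l))"
    by (intro sum.cong refl, subst parseval) (auto simp: eigendecompD(2)[OF A] power2_eq_square)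
  also have "\<dots> = (\<Sum>l<n. \<bar>mu l\<bar>)"
    by (intro sum.cong refl) (simp add: eigendecompD(1)[OF B])
  finally show ?thesis by (simp add: algebra_simps)
qed


section \<open>Resolvents\<close>

definition eigval :: "nat \<Rightarrow> (nat \<Rightarrow> nat \<Rightarrow> real) \<Rightarrow> nat \<Rightarrow> real" where
  "eigval n A = fst (SOME (lam, U). eigendecomp n A lam U)"

definition eigvec :: "nat \<Rightarrow> (nat \<Rightarrow> nat \<Rightarrow> real) \<Rightarrow> nat \<Rightarrow> nat \<Rightarrow> real" where
  "eigvec n A = snd (SOME (lam, U). eigendecomp n A lam U)"

lemma eigendecomp_eigval:
  assumes "\<And>i j. i < n \<Longrightarrow> j < n \<Longrightarrow> A i j = A j i"
  shows "eigendecomp n A (eigval n A) (eigvec n A)"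
proof -
  have "\<exists>x. case x of (lam, U) \<Rightarrow> eigendecomp n A lam U"
    using eigendecomp_exists[of n A] assms by auto
  from someI_ex[OF this] show ?thesis
    by (simp only: eigval_def eigvec_def case_prod_unfold)
qed

text \<open>
  The inverse of \<open>A - z I\<close>, defined by the functional calculus in the chosen eigenbasis: bounds on its
  entries then follow from Parseval's identity.
\<close>
definition resolvent :: "nat \<Rightarrow> (nat \<Rightarrow> nat \<Rightarrow> real) \<Rightarrow> complex \<Rightarrow> nat \<Rightarrow> nat \<Rightarrow> complex" where
  "resolvent n A z i j =
     (\<Sum>k<n. of_real (eigvec n A i k * eigvec n A j k) / (of_real (eigval n A k) - z))"

lemma resolvent_sym: "resolvent n A z i j = resolvent n A z j i"
  by (simp add: resolvent_def mult.commute)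

lemma real_minus_neq_0: "Im z > 0 \<Longrightarrow> complex_of_real x - z \<noteq> 0"
  by (auto simp: complex_eq_iff)

lemma norm_real_minus_ge: "Im z > 0 \<Longrightarrow> norm (complex_of_real x - z) \<ge> Im z"
  using abs_Im_le_cmod[of "complex_of_real x - z"] by simp

lemma resolvent_equation:
  assumes sym: "\<And>i j. i < n \<Longrightarrow> j < n \<Longrightarrow> A i j = A j i" and z: "Im z > 0"
    and "i < n" "m < n"
  shows "(\<Sum>j<n. of_real (A i j) * resolvent n A z j m) = of_bool (i = m) + z * resolvent n A z i m"
proof -
  define lam where "lam = eigval n A"
  define U where "U = eigvec n A"
  have e: "eigendecomp n A lam U" unfolding lam_def U_def by (rule eigendecomp_eigval) (rule sym)
  have AU: "(\<Sum>j<n. A i j * U j k) = lam k * U i k" if "k < n" for k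
  proof -
    have "(\<Sum>j<n. A i j * U j k) = (\<Sum>j<n. \<Sum>l<n. lam l * U i l * (U j l * U j k))"
      using \<open>i < n\<close> by (intro sum.cong refl) (simp add: eigendecompD(3)[OF e] sum_distrib_left sum_distrib_right algebra_simps)
    also have "\<dots> = (\<Sum>l<n. lam l * U i l * (\<Sum>j<n. U j l * U j k))"
      by (subst sum.swap) (simp add: sum_distrib_left)
    also have "\<dots> = (\<Sum>l<n. if l = k then lam l * U i l else 0)"
      using that by (intro sum.cong refl) (simp add: eigendecompD(1)[OF e])
    finally show ?thesis using that by simp
  qed
  have "(\<Sum>j<n. of_real (A i j) * resolvent n A z j m)
      = (\<Sum>k<n. \<Sum>j<n. of_real (A i j * U j k) * (of_real (U m k) / (of_real (lam k) - z)))"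
    unfolding resolvent_def lam_def[symmetric] U_def[symmetric]
    by (subst sum.swap) (simp add: sum_distrib_left algebra_simps)
  also have "\<dots> = (\<Sum>k<n. of_real (\<Sum>j<n. A i j * U j k) * (of_real (U m k) / (of_real (lam k) - z)))"
    by (simp only: sum_distrib_right of_real_sum)
  also have "\<dots> = (\<Sum>k<n. of_real (U i k * U m k) + z * (of_real (U i k * U m k) / (of_real (lam k) - z)))"
    using real_minus_neq_0[OF z]
    by (intro sum.cong refl) (simp add: AU field_simps)
  also have "\<dots> = of_real (\<Sum>k<n. U i k * U m k) + z * resolvent n A z i m"
    by (simp add: sum.distrib sum_distrib_left resolvent_def lam_def U_def)
  also have "(\<Sum>k<n. U i k * U m k) = of_bool (i = m)"
    using assms by (intro eigendecompD(2)[OF e])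
  finally show ?thesis by simp
qed

text \<open>
  Row \<open>i\<close> of the resolvent is an isometric image of the vector \<open>U i k / (lam k - z)\<close>, whose
  denominators have modulus at least \<open>Im z\<close>.
\<close>
lemma resolvent_row_norm:
  assumes sym: "\<And>i j. i < n \<Longrightarrow> j < n \<Longrightarrow> A i j = A j i" and z: "Im z > 0" and i: "i < n"
  shows "(\<Sum>j<n. norm (resolvent n A z i j) ^ 2) \<le> 1 / Im z ^ 2"
proof -
  define lam where "lam = eigval n A"
  define U where "U = eigvec n A"
  have e: "eigendecomp n A lam U" unfolding lam_def U_def by (rule eigendecomp_eigval) (rule sym)
  define c where "c k = of_real (U i k) / (of_real (lam k) - z)" for k
  have R: "resolvent n A z i j = (\<Sum>k<n. of_real (U j k) * c k)" for j
    by (simp add: resolvent_def c_def lam_def U_def algebra_simps)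
  have orth: "(\<Sum>j<n. U j k * U j l) = of_bool (k = l)" if "k < n" "l < n" for k l
    using that by (rule eigendecompD(1)[OF e])
  have "(\<Sum>j<n. norm (resolvent n A z i j) ^ 2)
      = (\<Sum>j<n. (\<Sum>k<n. U j k * Re (c k))^2) + (\<Sum>j<n. (\<Sum>k<n. U j k * Im (c k))^2)"
    by (simp add: R cmod_power2 sum.distrib)
  also have "\<dots> = (\<Sum>k<n. (Re (c k))^2) + (\<Sum>k<n. (Im (c k))^2)"
    by (simp add: parseval[of n "\<lambda>k j. U j k", OF orth])
  also have "\<dots> = (\<Sum>k<n. norm (c k) ^ 2)"
    by (simp add: cmod_power2 sum.distrib)
  also have "\<dots> \<le> (\<Sum>k<n. (U i k)^2 * (1 / Im z ^ 2))"
  proof (intro sum_mono)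
    fix k assume "k \<in> {..<n}"
    have "Im z ^ 2 \<le> norm (of_real (lam k) - z) ^ 2"
      using z by (intro power_mono norm_real_minus_ge) auto
    hence "1 / norm (of_real (lam k) - z) ^ 2 \<le> 1 / Im z ^ 2"
      using z by (intro divide_left_mono mult_pos_pos) (auto simp: real_minus_neq_0)
    hence "(U i k)^2 * (1 / norm (of_real (lam k) - z) ^ 2) \<le> (U i k)^2 * (1 / Im z ^ 2)"
      by (intro mult_left_mono) auto
    thus "norm (c k) ^ 2 \<le> (U i k)^2 * (1 / Im z ^ 2)"
      by (simp add: c_def norm_divide power_divide)
  qed
  also have "\<dots> = 1 / Im z ^ 2"
    using eigendecompD(2)[OF e i i]
    by (simp add: sum_distrib_right[symmetric] sum_divide_distrib[symmetric] power2_eq_square)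
  finally show ?thesis .
qed

lemma resolvent_entry_bound:
  assumes sym: "\<And>i j. i < n \<Longrightarrow> j < n \<Longrightarrow> A i j = A j i" and z: "Im z > 0" and ij: "i < n" "j < n"
  shows "norm (resolvent n A z i j) \<le> 1 / Im z"
proof -
  have "norm (resolvent n A z i j) ^ 2 \<le> (\<Sum>j<n. norm (resolvent n A z i j) ^ 2)"
    using ij by (intro member_le_sum) auto
  also have "\<dots> \<le> (1 / Im z) ^ 2"
    using resolvent_row_norm[of n A, OF sym z ij(1)] by (simp add: power_divide)
  finally show ?thesis using z by (simp add: power2_le_iff_abs_le)
qed

lemma resolvent_trace:
  assumes sym: "\<And>i j. i < n \<Longrightarrow> j < n \<Longrightarrow> A i j = A j i"
  shows "(\<Sum>i<n. resolvent n A z i i) = (\<Sum>k<n. 1 / (of_real (eigval n A k) - z))"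
proof -
  note e = eigendecomp_eigval[of n A, OF sym]
  have "(\<Sum>i<n. resolvent n A z i i)
      = (\<Sum>k<n. of_real (\<Sum>i<n. eigvec n A i k * eigvec n A i k) / (of_real (eigval n A k) - z))"
    unfolding resolvent_def by (subst sum.swap) (simp add: sum_divide_distrib)
  thus ?thesis by (simp add: eigendecompD(1)[OF e])
qed

text \<open>
  The resolvent identity \<open>S - R = R (A - B) S\<close> for the resolvents \<open>R\<close> of \<open>A\<close> and \<open>S\<close> of \<open>B\<close>: cancel
  \<open>z R S\<close> from \<open>(R A) S = S + z R S\<close> and \<open>R (B S) = R + z R S\<close>.
\<close>
lemma resolvent_difference:
  assumes symA: "\<And>i j. i < n \<Longrightarrow> j < n \<Longrightarrow> A i j = A j i"
    and symB: "\<And>i j. i < n \<Longrightarrow> j < n \<Longrightarrow> B i j = B j i"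
    and z: "Im z > 0" and ab: "a < n" "b < n"
  shows "resolvent n B z a b - resolvent n A z a b =
    (\<Sum>c<n. \<Sum>d<n. resolvent n A z a c * of_real (A c d - B c d) * resolvent n B z d b)"
proof -
  define R where "R = resolvent n A z"
  define S where "S = resolvent n B z"
  have RA: "(\<Sum>c<n. R a c * of_real (A c d)) = of_bool (a = d) + z * R a d" if "d < n" for d
  proof -
    have "(\<Sum>c<n. R a c * of_real (A c d)) = (\<Sum>c<n. of_real (A d c) * R c a)"
      using that by (intro sum.cong refl) (simp add: R_def resolvent_sym[of n A z a] symA mult.commute)
    thus ?thesis
      using resolvent_equation[of n A, OF symA z that ab(1)] by (simp add: R_def resolvent_sym[of n A z d a])
  qed
  have "(\<Sum>c<n. \<Sum>d<n. R a c * of_real (A c d - B c d) * S d b)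
      = (\<Sum>c<n. \<Sum>d<n. R a c * of_real (A c d) * S d b) - (\<Sum>c<n. \<Sum>d<n. R a c * (of_real (B c d) * S d b))"
    by (simp add: sum_subtractf algebra_simps)
  also have "(\<Sum>c<n. \<Sum>d<n. R a c * of_real (A c d) * S d b) = (\<Sum>d<n. (\<Sum>c<n. R a c * of_real (A c d)) * S d b)"
    by (subst sum.swap) (simp add: sum_distrib_right)
  also have "\<dots> = (\<Sum>d<n. (if d = a then S d b else 0) + z * (R a d * S d b))"
    by (intro sum.cong refl) (auto simp: RA algebra_simps)
  also have "\<dots> = S a b + z * (\<Sum>d<n. R a d * S d b)"
    using ab by (simp add: sum.distrib sum_distrib_left)
  also have "(\<Sum>c<n. \<Sum>d<n. R a c * (of_real (B c d) * S d b)) = (\<Sum>c<n. R a c * (\<Sum>d<n. of_real (B c d) * S d b))"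
    by (simp add: sum_distrib_left)
  also have "\<dots> = (\<Sum>c<n. (if c = b then R a c else 0) + z * (R a c * S c b))"
    using resolvent_equation[of n B, OF symB z _ ab(2)]
    by (intro sum.cong refl) (auto simp: S_def algebra_simps)
  also have "\<dots> = R a b + z * (\<Sum>c<n. R a c * S c b)"
    using ab by (simp add: sum.distrib sum_distrib_left)
  finally show ?thesis by (simp add: R_def S_def)
qed

text \<open>
  Up to sign, the change of the adjacency matrix when the edge between \<open>i\<close> and \<open>j\<close> is toggled.
\<close>
definition swap_entries :: "nat \<Rightarrow> nat \<Rightarrow> nat \<Rightarrow> nat \<Rightarrow> real" where
  "swap_entries i j c d = of_bool (c = i \<and> d = j) + of_bool (c = j \<and> d = i)"

lemma resolvent_difference_two_entries:
  assumes symA: "\<And>i j. i < n \<Longrightarrow> j < n \<Longrightarrow> A i j = A j i"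
    and symB: "\<And>i j. i < n \<Longrightarrow> j < n \<Longrightarrow> B i j = B j i"
    and AB: "\<And>c d. c < n \<Longrightarrow> d < n \<Longrightarrow> A c d - B c d = h * swap_entries i j c d"
    and ij: "i < n" "j < n"
    and z: "Im z > 0" and ab: "a < n" "b < n"
  shows "resolvent n B z a b - resolvent n A z a b =
    of_real h * (resolvent n A z a i * resolvent n B z j b + resolvent n A z a j * resolvent n B z i b)"
proof -
  define R where "R = resolvent n A z"
  define S where "S = resolvent n B z"
  have "resolvent n B z a b - resolvent n A z a b =
    (\<Sum>c<n. \<Sum>d<n. R a c * of_real (A c d - B c d) * S d b)"
    unfolding R_def S_def using assms by (intro resolvent_difference)
  also have "\<dots> = (\<Sum>c<n. \<Sum>d<n. (if d = j then (if c = i then of_real h * R a c * S d b else 0) else 0)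
      + (if d = i then (if c = j then of_real h * R a c * S d b else 0) else 0))"
    by (intro sum.cong refl) (auto simp: AB swap_entries_def)
  also have "\<dots> = (\<Sum>c<n. (if c = i then of_real h * R a c * S j b else 0)
      + (if c = j then of_real h * R a c * S i b else 0))"
    using ij by (simp add: sum.distrib)
  also have "\<dots> = of_real h * (R a i * S j b + R a j * S i b)"
    using ij by (simp add: sum.distrib algebra_simps)
  finally show ?thesis by (simp add: R_def S_def)
qed

lemma resolvent_entry_diff_bound:
  assumes symA: "\<And>i j. i < n \<Longrightarrow> j < n \<Longrightarrow> A i j = A j i"
    and symB: "\<And>i j. i < n \<Longrightarrow> j < n \<Longrightarrow> B i j = B j i"
    and AB: "\<And>c d. c < n \<Longrightarrow> d < n \<Longrightarrow> A c d - B c d = h * swap_entries i j c d"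
    and ij: "i < n" "j < n"
    and z: "Im z > 0" and ab: "a < n" "b < n"
  shows "norm (resolvent n B z a b - resolvent n A z a b) \<le> 2 * \<bar>h\<bar> / Im z ^ 2"
proof -
  note bA = resolvent_entry_bound[of n A, OF symA z] and bB = resolvent_entry_bound[of n B, OF symB z]
  have "norm (resolvent n A z a i * resolvent n B z j b + resolvent n A z a j * resolvent n B z i b)
     \<le> 1 / Im z * (1 / Im z) + 1 / Im z * (1 / Im z)"
    unfolding norm_mult[symmetric]
    by (rule norm_triangle_le, intro add_mono; simp only: norm_mult; intro mult_mono bA bB)
       (use ij ab z in auto)
  hence "\<bar>h\<bar> * norm (resolvent n A z a i * resolvent n B z j b + resolvent n A z a j * resolvent n B z i b)
     \<le> \<bar>h\<bar> * (1 / Im z * (1 / Im z) + 1 / Im z * (1 / Im z))"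
    by (intro mult_left_mono) auto
  moreover have "resolvent n B z a b - resolvent n A z a b =
    of_real h * (resolvent n A z a i * resolvent n B z j b + resolvent n A z a j * resolvent n B z i b)"
    using assms by (intro resolvent_difference_two_entries)
  ultimately show ?thesis
    by (simp add: norm_mult power2_eq_square mult.commute)
qed

text \<open>
  Each of the \<open>n\<close> diagonal entries changes by \<open>O(h)\<close>, but so does their sum: it is an inner product
  of rows of the two resolvents, and these have norm at most \<open>1 / Im z\<close>.
\<close>
lemma resolvent_trace_diff_bound:
  assumes symA: "\<And>i j. i < n \<Longrightarrow> j < n \<Longrightarrow> A i j = A j i"
    and symB: "\<And>i j. i < n \<Longrightarrow> j < n \<Longrightarrow> B i j = B j i"
    and AB: "\<And>c d. c < n \<Longrightarrow> d < n \<Longrightarrow> A c d - B c d = h * swap_entries i j c d"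
    and ij: "i < n" "j < n"
    and z: "Im z > 0"
  shows "norm ((\<Sum>a<n. resolvent n B z a a) - (\<Sum>a<n. resolvent n A z a a)) \<le> 2 * \<bar>h\<bar> / Im z ^ 2"
proof -
  define R where "R = resolvent n A z"
  define S where "S = resolvent n B z"
  have CS: "(\<Sum>a<n. norm (R a i * S j a)) \<le> 1 / Im z ^ 2" if "i < n" "j < n" for i j
  proof -
    have "norm (R a i * S j a) \<le> (norm (R i a) ^ 2 + norm (S j a) ^ 2) / 2" for a
      using sum_squares_bound[of "norm (R a i)" "norm (S j a)"]
      by (simp add: norm_mult R_def resolvent_sym[of n A z a])
    hence "(\<Sum>a<n. norm (R a i * S j a)) \<le> (\<Sum>a<n. (norm (R i a) ^ 2 + norm (S j a) ^ 2) / 2)"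
      by (intro sum_mono)
    also have "\<dots> = ((\<Sum>a<n. norm (R i a) ^ 2) + (\<Sum>a<n. norm (S j a) ^ 2)) / 2"
      by (simp add: sum.distrib sum_divide_distrib[symmetric])
    also have "\<dots> \<le> (1 / Im z ^ 2 + 1 / Im z ^ 2) / 2"
      unfolding R_def S_def using that z
      by (intro divide_right_mono add_mono resolvent_row_norm symA symB) auto
    finally show ?thesis by simp
  qed
  have "(\<Sum>a<n. resolvent n B z a a) - (\<Sum>a<n. resolvent n A z a a)
      = (\<Sum>a<n. of_real h * (R a i * S j a + R a j * S i a))"
    unfolding sum_subtractf[symmetric] R_def S_def
    by (intro sum.cong refl) (simp add: resolvent_difference_two_entries[of n A B, OF symA symB AB ij z])
  also have "norm \<dots> \<le> (\<Sum>a<n. norm (of_real h * (R a i * S j a + R a j * S i a)))"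
    by (rule norm_sum)
  also have "\<dots> \<le> (\<Sum>a<n. \<bar>h\<bar> * (norm (R a i * S j a) + norm (R a j * S i a)))"
    unfolding norm_mult[of "of_real h"] norm_of_real by (intro sum_mono mult_left_mono norm_triangle_ineq) auto
  also have "\<dots> = \<bar>h\<bar> * ((\<Sum>a<n. norm (R a i * S j a)) + (\<Sum>a<n. norm (R a j * S i a)))"
    by (simp only: sum_distrib_left[symmetric] sum.distrib)
  also have "\<dots> \<le> \<bar>h\<bar> * (1 / Im z ^ 2 + 1 / Im z ^ 2)"
    using ij by (intro mult_left_mono add_mono CS) auto
  finally show ?thesis by (simp add: mult.commute)
qed

section \<open>Independent coins\<close>

text \<open>
  Coins outside \<open>A\<close> show \<open>False\<close>, so that all coin configurations have one type and a coin can be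
  reset by a function update.
\<close>
definition coins :: "'a set \<Rightarrow> real \<Rightarrow> ('a \<Rightarrow> bool) pmf" where
  "coins A p = Pi_pmf A False (\<lambda>_. bernoulli_pmf p)"

lemma finite_set_pmf_coins: "finite A \<Longrightarrow> finite (set_pmf (coins A p))"
  unfolding coins_def by (subst set_Pi_pmf) (auto intro!: finite_PiE_dflt)

lemma integrable_coins [simp]:
  fixes F :: "('a \<Rightarrow> bool) \<Rightarrow> 'b::{banach, second_countable_topology}"
  shows "finite A \<Longrightarrow> integrable (measure_pmf (coins A p)) F"
  by (intro integrable_measure_pmf_finite finite_set_pmf_coins)

abbreviation expect :: "('a \<Rightarrow> bool) pmf \<Rightarrow> (('a \<Rightarrow> bool) \<Rightarrow> 'b::{banach, second_countable_topology}) \<Rightarrow> 'b" where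
  "expect M F \<equiv> measure_pmf.expectation M F"

lemma expect_coins_insert:
  fixes F :: "('a \<Rightarrow> bool) \<Rightarrow> 'b::{banach, second_countable_topology}"
  assumes "finite A" "e \<notin> A" "0 \<le> p" "p \<le> 1"
  shows "expect (coins (insert e A) p) F =
    p *\<^sub>R expect (coins A p) (\<lambda>f. F (f(e := True))) +
    (1 - p) *\<^sub>R expect (coins A p) (\<lambda>f. F (f(e := False)))"
proof -
  have "coins (insert e A) p = bernoulli_pmf p \<bind> (\<lambda>y. map_pmf (\<lambda>f. f(e := y)) (coins A p))"
    unfolding coins_def using assms by (subst Pi_pmf_insert') (auto simp: map_pmf_def)
  also have "expect \<dots> F =
      (\<Sum>y\<in>UNIV. pmf (bernoulli_pmf p) y *\<^sub>R expect (map_pmf (\<lambda>f. f(e := y)) (coins A p)) F)"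
    by (rule pmf_expectation_bind) (use assms in \<open>auto simp: finite_set_pmf_coins\<close>)
  also have "\<dots> = p *\<^sub>R expect (map_pmf (\<lambda>f. f(e := True)) (coins A p)) F
      + (1 - p) *\<^sub>R expect (map_pmf (\<lambda>f. f(e := False)) (coins A p)) F"
    using assms(3,4) unfolding UNIV_bool by (simp del: integral_map_pmf)
  finally show ?thesis unfolding integral_map_pmf .
qed

text \<open>
  Tossing the coin \<open>e\<close> once more leaves the distribution unchanged, because it is independent of the
  other coins.
\<close>
lemma expect_coins_resample:
  fixes F :: "('a \<Rightarrow> bool) \<Rightarrow> 'b::{banach, second_countable_topology}"
  assumes "finite A" "e \<in> A" "0 \<le> p" "p \<le> 1"
  shows "expect (coins A p) F =
    p *\<^sub>R expect (coins A p) (\<lambda>f. F (f(e := True))) +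
    (1 - p) *\<^sub>R expect (coins A p) (\<lambda>f. F (f(e := False)))"
proof -
  define B where "B = A - {e}"
  have B: "A = insert e B" "finite B" "e \<notin> B" using assms by (auto simp: B_def)
  note ins = expect_coins_insert[OF B(2,3) assms(3,4), folded B(1)]
  have "p *\<^sub>R x + (1 - p) *\<^sub>R x = x" for x :: 'b
    by (simp add: scaleR_left_diff_distrib)
  thus ?thesis
    by (simp add: ins[of F] ins[of "\<lambda>f. F (f(e := True))"] ins[of "\<lambda>f. F (f(e := False))"])
qed

text \<open>
  The discrete counterpart of Gaussian integration by parts.
\<close>
lemma expect_centred_coin_mult:
  fixes F :: "('a \<Rightarrow> bool) \<Rightarrow> 'b::{banach, second_countable_topology}"
  assumes "finite A" "e \<in> A" "0 \<le> p" "p \<le> 1"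
  shows "expect (coins A p) (\<lambda>f. (of_bool (f e) - p) *\<^sub>R F f) =
    (p * (1 - p)) *\<^sub>R expect (coins A p) (\<lambda>f. F (f(e := True)) - F (f(e := False)))"
  using assms
  by (subst expect_coins_resample[OF assms])
     (simp add: Bochner_Integration.integral_diff scaleR_right_diff_distrib algebra_simps)

lemma norm_convex_combination_sq:
  fixes a b :: "'b::real_inner"
  shows "norm (p *\<^sub>R a + (1 - p) *\<^sub>R b) ^ 2 =
    p * norm a ^ 2 + (1 - p) * norm b ^ 2 - p * (1 - p) * norm (a - b) ^ 2"
  by (simp add: power2_norm_eq_inner inner_add_left inner_add_right inner_diff_left inner_diff_right
      inner_commute[of b a] algebra_simps)

text \<open>
  The Efron--Stein inequality, by induction on the number of coins. Averaging over one coin replaces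
  \<open>F\<close> by \<open>G\<close>, which has the same expectation and again differences bounded by \<open>c\<close>; the variance that
  is lost is \<open>p (1 - p)\<close> times the expected squared difference in that coin.
\<close>
lemma coins_second_moment_le:
  fixes F :: "('a \<Rightarrow> bool) \<Rightarrow> 'b::{real_inner, banach, second_countable_topology}" and c :: real
  assumes "finite A" "0 \<le> p" "p \<le> 1"
    and "\<And>e f. e \<in> A \<Longrightarrow> norm (F (f(e := True)) - F (f(e := False))) \<le> c"
  shows "expect (coins A p) (\<lambda>f. norm (F f) ^ 2) \<le> norm (expect (coins A p) F) ^ 2 + card A * c ^ 2"
  using assms(1,4)
proof (induction A arbitrary: F rule: finite_induct)
  case empty
  show ?case by (simp add: coins_def)
next
  case (insert e A)
  let ?M = "coins A p"
  define G where "G f = p *\<^sub>R F (f(e := True)) + (1 - p) *\<^sub>R F (f(e := False))" for f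
  have pp: "0 \<le> p * (1 - p)" "p * (1 - p) \<le> 1"
    using assms(2,3) mult_le_one[of p "1 - p"] by simp_all
  have "expect (coins (insert e A) p) (\<lambda>f. norm (F f) ^ 2) =
      expect ?M (\<lambda>f. p * norm (F (f(e := True))) ^ 2 + (1 - p) * norm (F (f(e := False))) ^ 2)"
    using insert.hyps assms(2,3) by (simp add: expect_coins_insert)
  also have "\<dots> = expect ?M (\<lambda>f. norm (G f) ^ 2 +
      p * (1 - p) * norm (F (f(e := True)) - F (f(e := False))) ^ 2)"
    by (simp add: G_def norm_convex_combination_sq)
  also have "\<dots> \<le> expect ?M (\<lambda>f. norm (G f) ^ 2 + c ^ 2)"
  proof (intro integral_mono)
    fix f
    have "norm (F (f(e := True)) - F (f(e := False))) ^ 2 \<le> c ^ 2"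
      by (intro power_mono insert.prems) auto
    hence "p * (1 - p) * norm (F (f(e := True)) - F (f(e := False))) ^ 2 \<le> 1 * c ^ 2"
      using pp by (intro mult_mono) auto
    thus "norm (G f) ^ 2 + p * (1 - p) * norm (F (f(e := True)) - F (f(e := False))) ^ 2
        \<le> norm (G f) ^ 2 + c ^ 2" by simp
  qed (use insert.hyps in auto)
  also have "\<dots> = expect ?M (\<lambda>f. norm (G f) ^ 2) + c ^ 2"
    using insert.hyps by simp
  also have "expect ?M (\<lambda>f. norm (G f) ^ 2) \<le> norm (expect ?M G) ^ 2 + card A * c ^ 2"
  proof (rule insert.IH)
    fix e' f assume "e' \<in> A"
    hence "e' \<noteq> e" using insert by auto
    hence "G (f(e' := True)) - G (f(e' := False)) =
       p *\<^sub>R (F ((f(e := True))(e' := True)) - F ((f(e := True))(e' := False))) +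
       (1 - p) *\<^sub>R (F ((f(e := False))(e' := True)) - F ((f(e := False))(e' := False)))"
      by (simp add: G_def fun_upd_twist[of e'] scaleR_right_diff_distrib)
    also have "norm \<dots> \<le> p * c + (1 - p) * c"
      using insert.prems[of e' "f(e := True)"] insert.prems[of e' "f(e := False)"] \<open>e' \<in> A\<close> assms(2,3)
      by (intro norm_triangle_le add_mono) (auto intro!: mult_left_mono simp del: fun_upd_apply)
    finally show "norm (G (f(e' := True)) - G (f(e' := False))) \<le> c" by (simp add: algebra_simps)
  qed
  also have "expect ?M G = expect (coins (insert e A) p) F"
    unfolding expect_coins_insert[OF insert.hyps assms(2,3)] G_def using insert.hyps by simp
  finally show ?case using insert.hyps by (simp add: algebra_simps)
qed

lemma coins_variance:
  fixes F :: "('a \<Rightarrow> bool) \<Rightarrow> 'b::{real_inner, banach, second_countable_topology}" and c :: real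
  assumes "finite A" "0 \<le> p" "p \<le> 1"
    and "\<And>e f. e \<in> A \<Longrightarrow> norm (F (f(e := True)) - F (f(e := False))) \<le> c"
  shows "expect (coins A p) (\<lambda>f. norm (F f - expect (coins A p) F) ^ 2) \<le> card A * c ^ 2"
proof -
  define m where "m = expect (coins A p) F"
  have "expect (coins A p) (\<lambda>f. norm (F f - m) ^ 2) =
      expect (coins A p) (\<lambda>f. norm (F f) ^ 2 - 2 * inner (F f) m + norm m ^ 2)"
    by (intro Bochner_Integration.integral_cong refl)
       (simp add: power2_norm_eq_inner inner_diff_left inner_diff_right inner_commute)
  also have "\<dots> = expect (coins A p) (\<lambda>f. norm (F f) ^ 2) - 2 * inner m m + norm m ^ 2"
    using assms by (simp add: m_def integral_inner_left)
  also have "\<dots> = expect (coins A p) (\<lambda>f. norm (F f) ^ 2) - norm m ^ 2"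
    by (simp add: power2_norm_eq_inner)
  also have "\<dots> \<le> card A * c ^ 2"
    using coins_second_moment_le[OF assms] by (simp add: m_def)
  finally show ?thesis by (simp add: m_def)
qed

section \<open>The centred adjacency matrix\<close>

text \<open>
  The scaling by \<open>sqrt n\<close> keeps the eigenvalues of order one.
\<close>
definition wigner :: "nat \<Rightarrow> real \<Rightarrow> (nat set \<Rightarrow> bool) \<Rightarrow> nat \<Rightarrow> nat \<Rightarrow> real" where
  "wigner n p f i j = (if i = j then 0 else (of_bool (f {i, j}) - p) / sqrt n)"

definition stieltjes :: "nat \<Rightarrow> real \<Rightarrow> complex \<Rightarrow> (nat set \<Rightarrow> bool) \<Rightarrow> complex" where
  "stieltjes n p z f = (\<Sum>i<n. resolvent n (wigner n p f) z i i) / n"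

lemma wigner_sym: "wigner n p f i j = wigner n p f j i"
  by (simp add: wigner_def insert_commute)

lemma finite_possible_edges [simp]: "finite (possible_edges n)"
  unfolding possible_edges_def by (rule finite_subset[of _ "Pow {..<n}"]) auto

lemma card_possible_edges: "real (card (possible_edges n)) \<le> real n ^ 2"
proof -
  have "card (possible_edges n) = n choose 2"
    unfolding possible_edges_def using n_subsets[of "{..<n}" 2] by simp
  also have "\<dots> \<le> n * (n - 1)" by (simp add: choose_two)
  also have "\<dots> \<le> n ^ 2" by (simp add: power2_eq_square)
  finally show ?thesis by (metis of_nat_le_iff of_nat_power)
qed

lemma pair_in_possible_edges: "i < n \<Longrightarrow> j < n \<Longrightarrow> i \<noteq> j \<Longrightarrow> {i, j} \<in> possible_edges n"
  by (auto simp: possible_edges_def)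

lemma possible_edgesE:
  assumes "e \<in> possible_edges n"
  obtains i j where "i < n" "j < n" "i \<noteq> j" "e = {i, j}"
  using assms by (auto simp: possible_edges_def card_2_iff)

lemma wigner_flip:
  assumes "i \<noteq> j"
  shows "wigner n p f c d - wigner n p (f({i, j} := b)) c d
      = ((of_bool (f {i, j}) - of_bool b) / sqrt n) * swap_entries i j c d"
  using assms by (auto simp: wigner_def swap_entries_def doubleton_eq_iff diff_divide_distrib insert_commute)

lemma wigner_flip_False_True:
  assumes "i \<noteq> j"
  shows "wigner n p (f({i, j} := False)) c d - wigner n p (f({i, j} := True)) c d
      = (- 1 / sqrt n) * swap_entries i j c d"
  using assms by (auto simp: wigner_def swap_entries_def doubleton_eq_iff diff_divide_distrib)

text \<open>
  There are at most \<open>n^2\<close> edges, and toggling one of them changes \<open>stieltjes\<close> by \<open>O(n powr (- 3 / 2))\<close>.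
\<close>
lemma stieltjes_variance:
  assumes p: "0 \<le> p" "p \<le> 1" and z: "Im z > 0"
  shows "expect (coins (possible_edges n) p)
      (\<lambda>f. norm (stieltjes n p z f - expect (coins (possible_edges n) p) (stieltjes n p z)) ^ 2)
    \<le> 4 / (n * Im z ^ 4)"
proof (cases "n = 0")
  case False
  define c where "c = 2 / (n * sqrt n * Im z ^ 2)"
  have bd: "norm (stieltjes n p z (f(e := True)) - stieltjes n p z (f(e := False))) \<le> c"
    if edge: "e \<in> possible_edges n" for e f
  proof -
    obtain i j where e: "i < n" "j < n" "i \<noteq> j" "e = {i, j}"
      using possible_edgesE[OF edge] .
    let ?A = "wigner n p (f(e := False))" and ?B = "wigner n p (f(e := True))"
    have "norm ((\<Sum>a<n. resolvent n ?B z a a) - (\<Sum>a<n. resolvent n ?A z a a))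
        \<le> 2 * \<bar>- 1 / sqrt n\<bar> / Im z ^ 2"
      unfolding e(4) using e z
      by (intro resolvent_trace_diff_bound[of n _ _ _ i j] wigner_flip_False_True wigner_sym) auto
    hence "norm ((\<Sum>a<n. resolvent n ?B z a a) - (\<Sum>a<n. resolvent n ?A z a a)) / n
        \<le> (2 * \<bar>- 1 / sqrt n\<bar> / Im z ^ 2) / n"
      by (intro divide_right_mono) auto
    also have "\<dots> = c" using False by (simp add: c_def abs_divide)
    also have "norm ((\<Sum>a<n. resolvent n ?B z a a) - (\<Sum>a<n. resolvent n ?A z a a)) / n
        = norm (stieltjes n p z (f(e := True)) - stieltjes n p z (f(e := False)))"
      unfolding stieltjes_def diff_divide_distrib[symmetric] norm_divide by simp
    finally show ?thesis .
  qed
  have "expect (coins (possible_edges n) p)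
      (\<lambda>f. norm (stieltjes n p z f - expect (coins (possible_edges n) p) (stieltjes n p z)) ^ 2)
    \<le> card (possible_edges n) * c ^ 2"
    using p bd by (intro coins_variance) auto
  also have "\<dots> \<le> real n ^ 2 * c ^ 2"
    by (intro mult_right_mono card_possible_edges) auto
  also have "\<dots> = 4 / (n * Im z ^ 4)"
    using False z by (simp add: c_def field_simps power2_eq_square power4_eq_xxxx)
  finally show ?thesis .
qed (simp add: stieltjes_def[abs_def])

lemma norm_mult_diff_le:
  fixes a b a' b' :: complex
  assumes "norm (a' - a) \<le> d" "norm (b' - b) \<le> d" "norm b' \<le> m" "norm a \<le> m"
  shows "norm (a' * b' - a * b) \<le> 2 * d * m"
proof -
  have "a' * b' - a * b = (a' - a) * b' + a * (b' - b)"
    by (simp add: algebra_simps)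
  also have "norm \<dots> \<le> d * m + m * d"
    using assms order_trans[OF norm_ge_zero assms(1)] order_trans[OF norm_ge_zero assms(4)]
    by (intro norm_triangle_le add_mono; simp only: norm_mult; intro mult_mono) auto
  finally show ?thesis by simp
qed

text \<open>
  Integration by parts in the coin of the edge between \<open>i\<close> and \<open>j\<close> gives products of entries of the
  resolvents with and without that edge. Replacing both by \<open>R\<close> costs one more factor \<open>1 / sqrt n\<close>.
  For \<open>i = j\<close> there is no coin: the matrix entry is zero and the products are bounded trivially, which
  is harmless as there are only \<open>n\<close> such pairs.
\<close>
lemma wigner_entry_expectation:
  fixes n :: nat
  assumes p: "0 \<le> p" "p \<le> 1" and z: "Im z > 0" and ij: "i < n" "j < n"
  defines "M \<equiv> coins (possible_edges n) p"
    and "R \<equiv> \<lambda>f. resolvent n (wigner n p f) z"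
  shows "norm (expect M (\<lambda>f. of_real (wigner n p f i j) * R f j i)
      + of_real (p * (1 - p) / n) * expect M (\<lambda>f. R f j i ^ 2 + R f j j * R f i i))
    \<le> (8 / (sqrt n * Im z ^ 3) + of_bool (i = j) * (2 / Im z ^ 2)) / n"
proof -
  define s2 where "s2 = p * (1 - p)"
  have s2: "0 \<le> s2" "s2 \<le> 1"
    using p mult_le_one[of p "1 - p"] by (auto simp: s2_def)
  have n: "n > 0" using ij by simp
  have bR: "norm (R f a b) \<le> 1 / Im z" if "a < n" "b < n" for f a b
    unfolding R_def using that z by (intro resolvent_entry_bound wigner_sym) auto
  have int [simp]: "integrable (measure_pmf M) F" for F :: "_ \<Rightarrow> complex"
    unfolding M_def by simp
  show ?thesis
  proof (cases "i = j")
    case True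
    have "norm (expect M (\<lambda>f. R f j i ^ 2 + R f j j * R f i i)) \<le> 2 / Im z ^ 2"
    proof (rule order_trans[OF integral_norm_bound])
      have "norm (R f j i ^ 2 + R f j j * R f i i) \<le> 1 / Im z * (1 / Im z) + 1 / Im z * (1 / Im z)" for f
        unfolding power2_eq_square
        by (rule norm_triangle_le, intro add_mono; simp only: norm_mult; intro mult_mono bR)
           (use ij z in auto)
      thus "expect M (\<lambda>f. norm (R f j i ^ 2 + R f j j * R f i i)) \<le> 2 / Im z ^ 2"
        by (intro measure_pmf.integral_le_const) (auto simp: power2_eq_square M_def)
    qed
    hence "s2 / n * norm (expect M (\<lambda>f. R f j i ^ 2 + R f j j * R f i i)) \<le> 1 / n * (2 / Im z ^ 2)"
      using s2 by (intro mult_mono divide_right_mono) auto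
    moreover have "0 \<le> 8 / (sqrt n * Im z ^ 3)" using z by simp
    ultimately have "s2 / n * norm (expect M (\<lambda>f. R f j i ^ 2 + R f j j * R f i i))
        \<le> (8 / (sqrt n * Im z ^ 3) + of_bool (i = j) * (2 / Im z ^ 2)) / n"
      using True n by (simp add: add_divide_distrib add_increasing mult.commute)
    thus ?thesis
      using True s2 by (simp add: wigner_def norm_mult norm_divide s2_def[symmetric])
  next
    case False
    define e where "e = {i, j}"
    have e: "e \<in> possible_edges n" using pair_in_possible_edges ij False by (simp add: e_def)
    define RT where "RT f = R (f(e := True))" for f
    define RF where "RF f = R (f(e := False))" for f
    have diff: "RT f j i - RF f j i = - (1 / sqrt n) * (RF f j i * RT f j i + RF f j j * RT f i i)" for f
    proof -
      have "RT f j i - RF f j i = of_real (- 1 / sqrt n) * (RF f j i * RT f j i + RF f j j * RT f i i)"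
        unfolding RT_def RF_def R_def e_def using ij z False
        by (intro resolvent_difference_two_entries wigner_flip_False_True wigner_sym) auto
      thus ?thesis by simp
    qed
    have near: "norm (R (f(e := b)) x y - R f x y) \<le> 2 / (sqrt n * Im z ^ 2)" if "x < n" "y < n" for f b x y
    proof -
      have "norm (R (f(e := b)) x y - R f x y) \<le> 2 * \<bar>(of_bool (f {i, j}) - of_bool b) / sqrt n\<bar> / Im z ^ 2"
        unfolding R_def e_def using ij z False that
        by (intro resolvent_entry_diff_bound[of n _ _ _ i j] wigner_flip wigner_sym) auto
      also have "\<dots> \<le> 2 * (1 / sqrt n) / Im z ^ 2"
        by (intro divide_right_mono mult_left_mono) (auto simp: abs_divide intro!: divide_right_mono)
      finally show ?thesis by simp
    qed
    have prod: "norm (RF f a b * RT f c d - R f a b * R f c d) \<le> 4 / (sqrt n * Im z ^ 3)"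
      if "a < n" "b < n" "c < n" "d < n" for f a b c d
    proof -
      have "norm (RF f a b * RT f c d - R f a b * R f c d) \<le> 2 * (2 / (sqrt n * Im z ^ 2)) * (1 / Im z)"
        unfolding RF_def RT_def using that by (intro norm_mult_diff_le near bR)
      thus ?thesis by (simp add: power3_eq_cube power2_eq_square mult_ac)
    qed
    have "expect M (\<lambda>f. of_real (wigner n p f i j) * R f j i)
        = expect M (\<lambda>f. of_real (1 / sqrt n) * ((of_bool (f e) - p) *\<^sub>R R f j i))"
      using False by (intro Bochner_Integration.integral_cong refl)
        (simp add: wigner_def e_def scaleR_conv_of_real)
    also have "\<dots> = of_real (1 / sqrt n) * expect M (\<lambda>f. (of_bool (f e) - p) *\<^sub>R R f j i)"
      by (rule integral_mult_right_zero)
    also have "expect M (\<lambda>f. (of_bool (f e) - p) *\<^sub>R R f j i)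
        = s2 *\<^sub>R expect M (\<lambda>f. RT f j i - RF f j i)"
      unfolding M_def s2_def RT_def RF_def using e p
      by (intro expect_centred_coin_mult) auto
    also have "expect M (\<lambda>f. RT f j i - RF f j i)
        = - (1 / sqrt n) * expect M (\<lambda>f. RF f j i * RT f j i + RF f j j * RT f i i)"
      unfolding diff by (rule integral_mult_right_zero)
    finally have E1: "expect M (\<lambda>f. of_real (wigner n p f i j) * R f j i)
        = - of_real (s2 / n) * expect M (\<lambda>f. RF f j i * RT f j i + RF f j j * RT f i i)"
      using n by (simp add: scaleR_conv_of_real field_simps flip: of_real_mult)
    have eq: "expect M (\<lambda>f. of_real (wigner n p f i j) * R f j i)
          + of_real (s2 / n) * expect M (\<lambda>f. R f j i ^ 2 + R f j j * R f i i)
        = - of_real (s2 / n) * expect M (\<lambda>f. (RF f j i * RT f j i - R f j i * R f j i) + (RF f j j * RT f i i - R f j j * R f i i))"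
      unfolding E1 by (simp add: algebra_simps power2_eq_square)
    have "norm (expect M (\<lambda>f. of_real (wigner n p f i j) * R f j i)
          + of_real (s2 / n) * expect M (\<lambda>f. R f j i ^ 2 + R f j j * R f i i))
        = s2 / n * norm (expect M (\<lambda>f. (RF f j i * RT f j i - R f j i * R f j i) + (RF f j j * RT f i i - R f j j * R f i i)))"
      unfolding eq using s2 by (simp add: norm_mult norm_divide)
    also have "\<dots> \<le> 1 / n * (8 / (sqrt n * Im z ^ 3))"
    proof -
      have "norm ((RF f j i * RT f j i - R f j i * R f j i) + (RF f j j * RT f i i - R f j j * R f i i))
          \<le> 4 / (sqrt n * Im z ^ 3) + 4 / (sqrt n * Im z ^ 3)" for f
        by (rule norm_triangle_mono; rule prod) (rule ij)+
      hence "expect M (\<lambda>f. norm ((RF f j i * RT f j i - R f j i * R f j i) + (RF f j j * RT f i i - R f j j * R f i i)))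
          \<le> 8 / (sqrt n * Im z ^ 3)"
        by (intro measure_pmf.integral_le_const) (auto simp: M_def)
      from order_trans[OF integral_norm_bound this] show ?thesis
        by (rule mult_mono[rotated]) (use s2 in \<open>auto intro: divide_right_mono\<close>)
    qed
    finally show ?thesis using False by (simp add: s2_def mult.commute)
  qed
qed

text \<open>
  Sum \<open>wigner_entry_expectation\<close> over all \<open>i\<close> and \<open>j\<close> and divide by \<open>n\<close>. The products \<open>R j j * R i i\<close> add up to the
  square of the Stieltjes transform \<open>s\<close>; the squares \<open>R j i ^ 2\<close>, collected in \<open>Q\<close>, contribute only
  \<open>O(1 / n)\<close>, since the rows of \<open>R\<close> are bounded. Finally \<open>E (s^2) - (E s)^2\<close> is at most the variance.
\<close>
lemma stieltjes_fixed_point_expect: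
  assumes p: "0 \<le> p" "p \<le> 1" and z: "Im z > 0" and n: "n > 0"
  defines "m \<equiv> expect (coins (possible_edges n) p) (stieltjes n p z)"
  shows "norm (1 + z * m + of_real (p * (1 - p)) * m ^ 2)
    \<le> 8 / (sqrt n * Im z ^ 3) + 3 / (n * Im z ^ 2) + 4 / (n * Im z ^ 4)"
proof -
  define M where "M = coins (possible_edges n) p"
  define R where "R f = resolvent n (wigner n p f) z" for f
  define s where "s = stieltjes n p z"
  define s2 where "s2 = p * (1 - p)"
  have s2: "0 \<le> s2" "s2 \<le> 1"
    using p mult_le_one[of p "1 - p"] by (auto simp: s2_def)
  have int [simp]: "integrable (measure_pmf M) F" for F :: "_ \<Rightarrow> complex"
    unfolding M_def by simp
  have intr [simp]: "integrable (measure_pmf M) F" for F :: "_ \<Rightarrow> real"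
    unfolding M_def by simp
  have m: "m = expect M s" by (simp add: m_def M_def s_def)
  have s_eq: "s f = (\<Sum>i<n. R f i i) / n" for f
    by (simp add: s_def R_def stieltjes_def)
  define Q where "Q f = (\<Sum>i<n. \<Sum>j<n. R f j i ^ 2) / n ^ 2" for f
  have LHS: "(\<Sum>i<n. \<Sum>j<n. expect M (\<lambda>f. of_real (wigner n p f i j) * R f j i)) / n = 1 + z * m"
  proof -
    have "(\<Sum>i<n. \<Sum>j<n. of_real (wigner n p f i j) * R f j i) / n = 1 + z * s f" for f
    proof -
      have "(\<Sum>i<n. \<Sum>j<n. of_real (wigner n p f i j) * R f j i) = (\<Sum>i<n. 1 + z * R f i i)"
        unfolding R_def using z by (intro sum.cong refl) (subst resolvent_equation; simp add: wigner_sym)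
      thus ?thesis using n by (simp add: s_eq sum.distrib sum_distrib_left field_simps)
    qed
    hence "expect M (\<lambda>f. (\<Sum>i<n. \<Sum>j<n. of_real (wigner n p f i j) * R f j i) / n) = expect M (\<lambda>f. 1 + z * s f)"
      by simp
    thus ?thesis by (simp add: m)
  qed
  have RHS: "(\<Sum>i<n. \<Sum>j<n. of_real (s2 / n) * expect M (\<lambda>f. R f j i ^ 2 + R f j j * R f i i)) / n
      = of_real s2 * (expect M Q + expect M (\<lambda>f. s f ^ 2))"
  proof -
    have "Q f + s f ^ 2 = (\<Sum>i<n. \<Sum>j<n. R f j i ^ 2 + R f j j * R f i i) / n ^ 2" for f
      by (simp add: Q_def s_eq power2_eq_square sum_product sum.distrib add_divide_distrib mult.commute)
    hence "expect M (\<lambda>f. Q f + s f ^ 2) = (\<Sum>i<n. \<Sum>j<n. expect M (\<lambda>f. R f j i ^ 2 + R f j j * R f i i)) / n ^ 2"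
      by simp
    moreover have "expect M (\<lambda>f. Q f + s f ^ 2) = expect M Q + expect M (\<lambda>f. s f ^ 2)"
      by simp
    ultimately show ?thesis
      using n unfolding sum_distrib_left[symmetric] by (simp add: power2_eq_square)
  qed
  have "norm (1 + z * m + of_real s2 * (expect M Q + expect M (\<lambda>f. s f ^ 2)))
      = norm (\<Sum>i<n. \<Sum>j<n. expect M (\<lambda>f. of_real (wigner n p f i j) * R f j i)
          + of_real (s2 / n) * expect M (\<lambda>f. R f j i ^ 2 + R f j j * R f i i)) / n"
    unfolding LHS[symmetric] RHS[symmetric] add_divide_distrib[symmetric] sum.distrib
    using n by (simp add: norm_divide)
  also have "\<dots> \<le> (\<Sum>i<n. \<Sum>j<n. (8 / (sqrt n * Im z ^ 3) + of_bool (i = j) * (2 / Im z ^ 2)) / n) / n"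
    unfolding M_def R_def s2_def
    by (intro divide_right_mono order_trans[OF norm_sum] sum_mono wigner_entry_expectation p z) auto
  also have "\<dots> = 8 / (sqrt n * Im z ^ 3) + 2 / (n * Im z ^ 2)"
  proof -
    have "(\<Sum>j<n. (8 / (sqrt n * Im z ^ 3) + of_bool (i = j) * (2 / Im z ^ 2)) / n)
        = 8 / (sqrt n * Im z ^ 3) + 2 / (n * Im z ^ 2)" if "i < n" for i
    proof -
      have "(\<Sum>j<n. (8 / (sqrt n * Im z ^ 3) + of_bool (i = j) * (2 / Im z ^ 2)) / n)
         = (\<Sum>j<n. 8 / (sqrt n * Im z ^ 3) / n + (if i = j then 2 / Im z ^ 2 / n else 0))"
        by (intro sum.cong refl) (auto simp: add_divide_distrib)
      thus ?thesis using that n by (simp add: sum.distrib mult.commute)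
    qed
    thus ?thesis using n by simp
  qed
  finally have B1: "norm (1 + z * m + of_real s2 * (expect M Q + expect M (\<lambda>f. s f ^ 2)))
      \<le> 8 / (sqrt n * Im z ^ 3) + 2 / (n * Im z ^ 2)" .
  have B2: "norm (expect M Q) \<le> 1 / (n * Im z ^ 2)"
  proof (rule order_trans[OF integral_norm_bound])
    have "norm (Q f) \<le> 1 / (n * Im z ^ 2)" for f
    proof -
      have "norm (\<Sum>i<n. \<Sum>j<n. R f j i ^ 2) \<le> (\<Sum>i<n. \<Sum>j<n. norm (R f i j) ^ 2)"
        by (intro order_trans[OF norm_sum] sum_mono)
           (simp add: norm_power R_def resolvent_sym[of n _ z _ "_::nat"])
      also have "\<dots> \<le> (\<Sum>i<n. 1 / Im z ^ 2)"
        unfolding R_def using z by (intro sum_mono resolvent_row_norm wigner_sym) auto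
      finally have "norm (\<Sum>i<n. \<Sum>j<n. R f j i ^ 2) / n ^ 2 \<le> (n / Im z ^ 2) / n ^ 2"
        by (intro divide_right_mono) auto
      thus ?thesis using n by (simp add: Q_def norm_divide norm_mult power2_eq_square mult_ac)
    qed
    thus "expect M (\<lambda>f. norm (Q f)) \<le> 1 / (n * Im z ^ 2)"
      by (intro measure_pmf.integral_le_const) auto
  qed
  have B3: "norm (m ^ 2 - expect M (\<lambda>f. s f ^ 2)) \<le> 4 / (n * Im z ^ 4)"
  proof -
    have "expect M (\<lambda>f. (s f - m) ^ 2) = expect M (\<lambda>f. s f ^ 2 - 2 * m * s f + m ^ 2)"
      by (intro Bochner_Integration.integral_cong refl) (simp add: power2_eq_square algebra_simps)
    also have "\<dots> = expect M (\<lambda>f. s f ^ 2) - 2 * m * expect M s + m ^ 2"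
      by simp
    also have "\<dots> = expect M (\<lambda>f. s f ^ 2) - m ^ 2"
      by (simp add: m power2_eq_square)
    finally have "norm (m ^ 2 - expect M (\<lambda>f. s f ^ 2)) = norm (expect M (\<lambda>f. (s f - m) ^ 2))"
      by (simp add: norm_minus_commute)
    also have "\<dots> \<le> expect M (\<lambda>f. norm (s f - m) ^ 2)"
      using integral_norm_bound[of "measure_pmf M" "\<lambda>f. (s f - m) ^ 2"] by (simp add: norm_power)
    also have "\<dots> \<le> 4 / (n * Im z ^ 4)"
      using stieltjes_variance[OF p z, of n] by (simp add: M_def s_def m_def)
    finally show ?thesis .
  qed
  have eq: "1 + z * m + of_real s2 * m ^ 2
      = (1 + z * m + of_real s2 * (expect M Q + expect M (\<lambda>f. s f ^ 2)))
        + of_real s2 * ((m ^ 2 - expect M (\<lambda>f. s f ^ 2)) + - expect M Q)"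
    by (simp add: algebra_simps)
  have "norm (1 + z * m + of_real s2 * m ^ 2) \<le> (8 / (sqrt n * Im z ^ 3) + 2 / (n * Im z ^ 2))
      + 1 * (4 / (n * Im z ^ 4) + 1 / (n * Im z ^ 2))"
    unfolding eq
  proof (rule norm_triangle_mono[OF B1])
    have "norm ((m ^ 2 - expect M (\<lambda>f. s f ^ 2)) + - expect M Q) \<le> 4 / (n * Im z ^ 4) + 1 / (n * Im z ^ 2)"
      by (rule norm_triangle_mono[OF B3]) (use B2 in simp)
    thus "norm (of_real s2 * ((m ^ 2 - expect M (\<lambda>f. s f ^ 2)) + - expect M Q))
        \<le> 1 * (4 / (n * Im z ^ 4) + 1 / (n * Im z ^ 2))"
      unfolding norm_mult using s2 by (intro mult_mono) auto
  qed
  thus ?thesis by (simp add: s2_def add_divide_distrib[symmetric] algebra_simps)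
qed

section \<open>Distances when all pairs have common neighbours\<close>

definition common_neighbours :: "nat \<Rightarrow> (nat set \<Rightarrow> bool) \<Rightarrow> bool" where
  "common_neighbours n f \<longleftrightarrow>
     (\<forall>i<n. \<forall>j<n. i \<noteq> j \<longrightarrow> (\<exists>k<n. k \<noteq> i \<and> k \<noteq> j \<and> f {i, k} \<and> f {j, k}))"

abbreviation coin_graph :: "nat \<Rightarrow> (nat set \<Rightarrow> bool) \<Rightarrow> nat pair_pre_digraph" where
  "coin_graph n f \<equiv> edge_graph n {e \<in> possible_edges n. f e}"

lemma parcs_coin_graph:
  "(i, j) \<in> parcs (coin_graph n f) \<longleftrightarrow> i < n \<and> j < n \<and> i \<noteq> j \<and> f {i, j}"
  by (auto simp: edge_graph_def possible_edges_def)

lemma graph_dist_eqI: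
  assumes "wf_digraph (with_proj G)"
    and ex: "pre_digraph.awalk (with_proj G) u xs v" "length xs = d"
    and min: "\<And>ys. pre_digraph.awalk (with_proj G) u ys v \<Longrightarrow> d \<le> length ys"
  shows "graph_dist G u v = real d"
proof -
  interpret wf_digraph "with_proj G" by fact
  have cost: "awalk_cost (\<lambda>_. 1) ys = real (length ys)" for ys :: "('a \<times> 'a) list"
    by (induction ys) auto
  have "\<mu> (\<lambda>_. 1) u v = ereal (real d)"
    unfolding \<mu>_def cost using ex min
    by (intro antisym INF_greatest INF_lower2[of xs]) auto
  thus ?thesis by (simp add: graph_dist_def)
qed

text \<open>
  Distinct vertices are at distance one if they are adjacent, and otherwise at distance two because
  of a common neighbour.
\<close>
lemma graph_dist_coin_graph:
  assumes good: "common_neighbours n f" and ij: "i < n" "j < n"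
  shows "graph_dist (coin_graph n f) i j = (if i = j then 0 else 2 - of_bool (f {i, j}))"
proof -
  let ?G = "coin_graph n f"
  interpret pair_graph ?G by (rule pair_graph_edge_graph)
  have wf: "wf_digraph (with_proj ?G)" by unfold_locales
  have verts: "x \<in> pverts ?G \<longleftrightarrow> x < n" for x by (simp add: edge_graph_def)
  have Nil: "awalk u [] v \<longleftrightarrow> u = v \<and> u < n" for u v
    by (simp add: awalk_Nil_iff verts)
  have Cons: "awalk u (e # es) v \<longleftrightarrow> e \<in> parcs ?G \<and> fst e = u \<and> awalk (snd e) es v" for u e es v
    by (auto simp: awalk_Cons_iff)
  note simps = Nil Cons parcs_coin_graph
  consider "i = j" | "i \<noteq> j" "f {i, j}" | "i \<noteq> j" "\<not> f {i, j}" by blast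
  thus ?thesis
  proof cases
    case 1
    have "graph_dist ?G i j = real 0"
      using 1 ij by (intro graph_dist_eqI[OF wf, of _ "[]"]) (auto simp: simps)
    thus ?thesis using 1 by simp
  next
    case 2
    have "graph_dist ?G i j = real 1"
    proof (rule graph_dist_eqI[OF wf])
      show "awalk i [(i, j)] j" using 2 ij by (simp add: simps)
      fix ys assume "awalk i ys j"
      thus "1 \<le> length ys" using 2 by (cases ys) (auto simp: simps)
    qed simp
    thus ?thesis using 2 by simp
  next
    case 3
    obtain k where k: "k < n" "k \<noteq> i" "k \<noteq> j" "f {i, k}" "f {j, k}"
      using good 3 ij by (auto simp: common_neighbours_def)
    have "graph_dist ?G i j = real 2"
    proof (rule graph_dist_eqI[OF wf])
      show "awalk i [(i, k), (k, j)] j" using k ij by (simp add: simps insert_commute)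
      fix ys assume ys: "awalk i ys j"
      show "2 \<le> length ys"
      proof (cases ys)
        case Nil
        thus ?thesis using ys 3 by (simp add: simps)
      next
        case (Cons e es)
        thus ?thesis using ys 3 by (cases e; cases es) (auto simp: simps)
      qed
    qed simp
    thus ?thesis using 3 by simp
  qed
qed

lemma gnp_eq: "gnp n p = map_pmf (coin_graph n) (coins (possible_edges n) p)"
  by (simp add: gnp_def coins_def)

text \<open>
  The coins of the two edges at \<open>k\<close> do not occur in the factors of the other vertices, so resampling
  them splits off the factor \<open>1 - p^2\<close>.
\<close>
lemma expect_no_common_neighbour:
  assumes p: "0 \<le> p" "p \<le> 1" and ij: "i < n" "j < n" "i \<noteq> j"
    and K: "finite K" "K \<subseteq> {..<n} - {i, j}"
  shows "expect (coins (possible_edges n) p) (\<lambda>f. \<Prod>k\<in>K. 1 - of_bool (f {i, k} \<and> f {j, k})) = (1 - p ^ 2) ^ card K"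
  using K
proof (induction K rule: finite_induct)
  case empty
  show ?case by simp
next
  case (insert k K)
  let ?E = "\<lambda>F :: _ \<Rightarrow> real. expect (coins (possible_edges n) p) F"
  define G :: "(nat set \<Rightarrow> bool) \<Rightarrow> real" where
    "G f = (\<Prod>k\<in>K. 1 - of_bool (f {i, k} \<and> f {j, k}))" for f
  define F :: "(nat set \<Rightarrow> bool) \<Rightarrow> real" where
    "F f = (1 - of_bool (f {i, k} \<and> f {j, k})) * G f" for f
  have k: "k < n" "k \<noteq> i" "k \<noteq> j" using insert.prems by auto
  have edges: "{i, k} \<in> possible_edges n" "{j, k} \<in> possible_edges n"
    using ij k by (auto intro!: pair_in_possible_edges)
  have ne: "{i, k} \<noteq> {j, k}" using ij k by (auto simp: doubleton_eq_iff)
  have upd: "G (f({i, k} := b)) = G f" "G (f({j, k} := b)) = G f" for f b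
    unfolding G_def using insert.hyps insert.prems ij k
    by (auto intro!: prod.cong simp: doubleton_eq_iff)
  have "?E F = p * ?E (\<lambda>f. F (f({i, k} := True))) + (1 - p) * ?E (\<lambda>f. F (f({i, k} := False)))"
    using expect_coins_resample[of "possible_edges n" "{i, k}" p F] edges p by simp
  also have "(\<lambda>f. F (f({i, k} := False))) = G"
    by (simp add: F_def upd fun_eq_iff)
  also have "(\<lambda>f. F (f({i, k} := True))) = (\<lambda>f. (1 - of_bool (f {j, k})) * G f)"
    using ne by (simp add: F_def upd fun_eq_iff)
  also have "?E \<dots> = (1 - p) * ?E G"
    using expect_coins_resample[of "possible_edges n" "{j, k}" p "\<lambda>f. (1 - of_bool (f {j, k})) * G f"] edges p
    by (simp add: upd)
  also have "?E G = (1 - p ^ 2) ^ card K"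
    unfolding G_def using insert by auto
  also have "F = (\<lambda>f. \<Prod>k\<in>insert k K. 1 - of_bool (f {i, k} \<and> f {j, k}))"
    using insert.hyps by (simp add: F_def G_def fun_eq_iff)
  finally show ?case
    using insert.hyps by (simp add: algebra_simps power2_eq_square)
qed

lemma prob_common_neighbours:
  assumes p: "0 \<le> p" "p \<le> 1"
  shows "measure_pmf.prob (coins (possible_edges n) p) {f. \<not> common_neighbours n f} \<le> real n ^ 2 * (1 - p ^ 2) ^ (n - 2)"
proof -
  let ?M = "coins (possible_edges n) p"
  define I where "I = {(i, j). i < n \<and> j < n \<and> i \<noteq> j}"
  have I: "I \<subseteq> {..<n} \<times> {..<n}" by (auto simp: I_def)
  have fin: "finite I" using I by (rule finite_subset) auto
  define Bad where "Bad = (\<lambda>(i, j). {f. \<forall>k\<in>{..<n} - {i, j}. \<not> (f {i, k} \<and> f {j, k})})"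
  have bad: "measure_pmf.prob ?M (Bad e) = (1 - p ^ 2) ^ (n - 2)" if "e \<in> I" for e
  proof -
    obtain i j where e: "e = (i, j)" "i < n" "j < n" "i \<noteq> j" using \<open>e \<in> I\<close> by (auto simp: I_def)
    let ?K = "{..<n} - {i, j}"
    have card: "card ?K = n - 2" using e by (subst card_Diff_subset) auto
    have "(\<Prod>k\<in>?K. 1 - of_bool (f {i, k} \<and> f {j, k})) = (indicator (Bad e) f :: real)" for f
    proof (cases "f \<in> Bad e")
      case True
      thus ?thesis by (auto simp: Bad_def e intro!: prod.neutral)
    next
      case False
      hence "\<exists>k\<in>?K. 1 - of_bool (f {i, k} \<and> f {j, k}) = (0::real)" by (auto simp: Bad_def e)
      thus ?thesis using False by (simp add: prod_zero)
    qed
    hence "expect ?M (indicator (Bad e) :: _ \<Rightarrow> real) = (1 - p ^ 2) ^ card ?K"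
      using expect_no_common_neighbour[OF p e(2,3,4), of ?K] by simp
    thus ?thesis by (simp add: card)
  qed
  have "{f. \<not> common_neighbours n f} \<subseteq> (\<Union>e\<in>I. Bad e)"
    by (fastforce simp: common_neighbours_def I_def Bad_def)
  hence "measure_pmf.prob ?M {f. \<not> common_neighbours n f} \<le> measure_pmf.prob ?M (\<Union>e\<in>I. Bad e)"
    by (intro measure_pmf.finite_measure_mono) auto
  also have "\<dots> \<le> (\<Sum>e\<in>I. measure_pmf.prob ?M (Bad e))"
    by (intro measure_pmf.finite_measure_subadditive_finite fin) auto
  also have "\<dots> = card I * (1 - p ^ 2) ^ (n - 2)"
    by (simp add: bad)
  also have "\<dots> \<le> real n ^ 2 * (1 - p ^ 2) ^ (n - 2)"
  proof (intro mult_right_mono)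
    have "card I \<le> card ({..<n} \<times> {..<n})" using I by (intro card_mono) auto
    thus "real (card I) \<le> real n ^ 2" by (simp add: power2_eq_square flip: of_nat_mult)
    show "0 \<le> (1 - p ^ 2) ^ (n - 2)" using p by (simp add: power_le_one)
  qed
  finally show ?thesis .
qed

section \<open>The mean absolute eigenvalue\<close>

definition half_line :: "real measure" where
  "half_line = restrict_space lborel {0<..}"

lemma space_half_line [simp]: "space half_line = {0<..}"
  by (simp add: half_line_def space_restrict_space)

text \<open>
  The fundamental theorem of calculus on the open half line. Its hypotheses at the end points are
  limits, so it also covers improper integrals.
\<close>
lemma half_line_FTC:
  fixes f F :: "real \<Rightarrow> real"
  assumes deriv: "\<And>t. t > 0 \<Longrightarrow> (F has_real_derivative f t) (at t)"
    and cont: "\<And>t. t > 0 \<Longrightarrow> isCont f t"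
    and nonneg: "\<And>t. t > 0 \<Longrightarrow> f t \<ge> 0"
    and lim0: "(F \<longlongrightarrow> A) (at_right 0)" and lim: "(F \<longlongrightarrow> B) at_top"
  shows "integrable half_line f" "integral\<^sup>L half_line f = B - A"
proof -
  have e: "einterval 0 \<infinity> = {0<..}" by (auto simp: einterval_def)
  have l0: "((F \<circ> real_of_ereal) \<longlongrightarrow> A) (at_right 0)"
    using lim0 by (simp add: zero_ereal_def ereal_tendsto_simps)
  have l1: "((F \<circ> real_of_ereal) \<longlongrightarrow> B) (at_left \<infinity>)"
    using lim by (simp add: ereal_tendsto_simps)
  have prem: "(0::ereal) < \<infinity>"
    "\<And>x. (0::ereal) < ereal x \<Longrightarrow> ereal x < \<infinity> \<Longrightarrow> DERIV F x :> f x"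
    "\<And>x. (0::ereal) < ereal x \<Longrightarrow> ereal x < \<infinity> \<Longrightarrow> isCont f x"
    "AE x in lborel. (0::ereal) < ereal x \<longrightarrow> ereal x < \<infinity> \<longrightarrow> 0 \<le> f x"
    using deriv cont nonneg by auto
  have "set_integrable lborel {0<..} f"
    using interval_integral_FTC_nonneg(1)[OF prem l0 l1] unfolding e .
  thus "integrable half_line f"
    unfolding half_line_def by (subst integrable_restrict_space) (auto simp: set_integrable_def)
  have "(LBINT x=0..\<infinity>. f x) = B - A"
    by (rule interval_integral_FTC_nonneg(2)[OF prem l0 l1])
  thus "integral\<^sup>L half_line f = B - A"
    unfolding half_line_def
    by (subst integral_restrict_space) (auto simp: interval_lebesgue_integral_def e set_lebesgue_integral_def)
qed

text \<open>
  Use the antiderivative \<open>\<bar>x\<bar> * arctan (t / \<bar>x\<bar>)\<close>.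
\<close>
lemma abs_arctan_integral:
  fixes x :: real
  shows "integrable half_line (\<lambda>t. x^2 / (x^2 + t^2))"
    and "integral\<^sup>L half_line (\<lambda>t. x^2 / (x^2 + t^2)) = pi / 2 * \<bar>x\<bar>"
proof -
  have *: "integrable half_line (\<lambda>t. x^2 / (x^2 + t^2)) \<and>
    integral\<^sup>L half_line (\<lambda>t. x^2 / (x^2 + t^2)) = pi / 2 * \<bar>x\<bar>"
  proof (cases "x = 0")
    case False
    define a where "a = \<bar>x\<bar>"
    have a: "a > 0" "x^2 = a^2" using False by (auto simp: a_def)
    have d: "((\<lambda>t. a * arctan (t / a)) has_real_derivative a^2 / (a^2 + t^2)) (at t)" for t
      using a by (auto intro!: derivative_eq_intros simp: field_simps power2_eq_square add_pos_nonneg)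
    have c: "isCont (\<lambda>t. a^2 / (a^2 + t^2)) t" for t
      using a by (intro continuous_intros) (simp add: sum_power2_eq_zero_iff)
    have l0: "((\<lambda>t. a * arctan (t / a)) \<longlongrightarrow> 0) (at_right 0)"
    proof -
      have "isCont (\<lambda>t. a * arctan (t / a)) 0" using a by (intro continuous_intros) auto
      hence "((\<lambda>t. a * arctan (t / a)) \<longlongrightarrow> 0) (at 0)" by (simp add: isCont_def)
      thus ?thesis by (rule filterlim_mono) (auto simp: at_within_le_at)
    qed
    have l1: "((\<lambda>t. a * arctan (t / a)) \<longlongrightarrow> a * (pi / 2)) at_top"
      using a by (intro tendsto_intros filterlim_compose[OF tendsto_arctan_at_top]) real_asymp
    from half_line_FTC[OF d c _ l0 l1] show ?thesis
      unfolding a(2) by (simp add: a_def)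
  qed simp
  thus "integrable half_line (\<lambda>t. x^2 / (x^2 + t^2))"
    "integral\<^sup>L half_line (\<lambda>t. x^2 / (x^2 + t^2)) = pi / 2 * \<bar>x\<bar>" by auto
qed

text \<open>
  The semicircle law of variance \<open>v\<close> is symmetric, so at \<open>\<i> t\<close> its Stieltjes transform is \<open>\<i>\<close> times
  a real number, namely this one.
\<close>
definition semicircle_stieltjes :: "real \<Rightarrow> real \<Rightarrow> real" where
  "semicircle_stieltjes v t = (sqrt (t^2 + 4 * v) - t) / (2 * v)"

lemma sqrt_semicircle_bounds:
  assumes "v > 0" "t > 0"
  shows "t < sqrt (t^2 + 4 * v)" "t * sqrt (t^2 + 4 * v) \<le> t^2 + 2 * v"
proof -
  show "t < sqrt (t^2 + 4 * v)" using assms by (intro real_less_rsqrt) auto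
  have "0 \<le> (sqrt (t^2 + 4 * v) - t)^2" by simp
  also have "\<dots> = (t^2 + 4 * v) - 2 * t * sqrt (t^2 + 4 * v) + t^2"
    using assms by (simp add: power2_diff add_nonneg_nonneg)
  finally show "t * sqrt (t^2 + 4 * v) \<le> t^2 + 2 * v" by simp
qed

text \<open>
  The value \<open>1 - t * semicircle_stieltjes v t\<close> is the integral of \<open>x^2 / (x^2 + t^2)\<close> against the
  semicircle law, so by \<open>abs_arctan_integral\<close> its integral over \<open>t\<close> is \<open>pi / 2\<close> times the first
  absolute moment \<open>8 sqrt v / (3 pi)\<close>.
\<close>
lemma semicircle_profile_integral:
  assumes v: "v > 0"
  shows "integrable half_line (\<lambda>t. 1 - t * semicircle_stieltjes v t)"
    and "integral\<^sup>L half_line (\<lambda>t. 1 - t * semicircle_stieltjes v t) = 4 / 3 * sqrt v"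
    and "t > 0 \<Longrightarrow> 0 \<le> 1 - t * semicircle_stieltjes v t"
proof -
  define F where "F t = t + t^3 / (6 * v) - (t^2 + 4 * v) * sqrt (t^2 + 4 * v) / (6 * v)" for t
  have pos: "t^2 + 4 * v > 0" for t using v by (intro add_nonneg_pos) auto
  have d: "(F has_real_derivative 1 - t * semicircle_stieltjes v t) (at t)" for t
  proof -
    define r where "r = sqrt (t^2 + 4 * v)"
    have r: "r > 0" "r^2 = t^2 + 4 * v" using pos[of t] by (auto simp: r_def)
    have "(F has_real_derivative 1 + 3 * t^2 / (6 * v) - ((t^2 + 4 * v) * (2 * t * (inverse r / 2)) + 2 * t * r) / (6 * v)) (at t)"
      unfolding F_def r_def using pos[of t] v
      by (auto intro!: derivative_eq_intros simp: power2_eq_square) (simp add: field_simps)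
    also have "(t^2 + 4 * v) * (2 * t * (inverse r / 2)) = t * r"
      unfolding r(2)[symmetric] using r(1) by (simp add: power2_eq_square field_simps)
    also have "1 + 3 * t^2 / (6 * v) - (t * r + 2 * t * r) / (6 * v) = 1 - t * semicircle_stieltjes v t"
      unfolding semicircle_stieltjes_def r_def[symmetric] using v by (simp add: field_simps power2_eq_square)
    finally show ?thesis .
  qed
  have c: "isCont (\<lambda>t. 1 - t * semicircle_stieltjes v t) t" for t
    unfolding semicircle_stieltjes_def using v by (intro continuous_intros) auto
  show nn: "0 \<le> 1 - t * semicircle_stieltjes v t" if "t > 0" for t
    using sqrt_semicircle_bounds[OF v that] v
    by (simp add: semicircle_stieltjes_def field_simps power2_eq_square)
  have l0: "(F \<longlongrightarrow> - 4 / 3 * sqrt v) (at_right 0)"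
  proof -
    have "isCont F 0" using d DERIV_isCont by blast
    hence "(F \<longlongrightarrow> F 0) (at 0)" by (simp add: isCont_def)
    moreover have "F 0 = - 4 / 3 * sqrt v"
      using v by (simp add: F_def real_sqrt_mult)
    ultimately show ?thesis by (metis filterlim_at_split)
  qed
  have l1: "(F \<longlongrightarrow> 0) at_top"
    unfolding F_def using v by real_asymp
  show "integrable half_line (\<lambda>t. 1 - t * semicircle_stieltjes v t)"
    by (rule half_line_FTC(1)[OF d c nn l0 l1])
  show "integral\<^sup>L half_line (\<lambda>t. 1 - t * semicircle_stieltjes v t) = 4 / 3 * sqrt v"
    using half_line_FTC(2)[OF d c nn l0 l1] by simp
qed

text \<open>
  The quadratic polynomial factors as \<open>v * (m - root) * (m - other root)\<close>. The other root lies on the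
  negative imaginary axis at distance at least \<open>t / v\<close> from the upper half plane, so a small value of
  the polynomial forces the first factor to be small.
\<close>
lemma semicircle_equation_stable:
  assumes v: "v > 0" and t: "t > 0" and m: "Im m \<ge> 0"
  shows "norm (m - \<i> * semicircle_stieltjes v t) \<le> norm (1 + (\<i> * t) * m + of_real v * m^2) / t"
proof -
  define r where "r = sqrt (t^2 + 4 * v)"
  have r: "r > t" "r^2 = t^2 + 4 * v"
    using sqrt_semicircle_bounds[OF v t] v by (auto simp: r_def)
  define \<alpha> where "\<alpha> = (r - t) / (2 * v)"
  define \<beta> where "\<beta> = (r + t) / (2 * v)"
  define a where "a = m - \<i> * of_real \<alpha>"
  define b where "b = m + \<i> * of_real \<beta>"
  have "of_real v * (a * b) = of_real v * m^2 + \<i> * of_real (v * (\<beta> - \<alpha>)) * m + of_real (v * (\<alpha> * \<beta>))"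
    by (simp add: a_def b_def algebra_simps power2_eq_square)
  also have "v * (\<beta> - \<alpha>) = t"
    using v by (simp add: \<alpha>_def \<beta>_def field_simps)
  also have "v * (\<alpha> * \<beta>) = (r^2 - t^2) / (4 * v)"
    using v by (simp add: \<alpha>_def \<beta>_def field_simps power2_eq_square)
  also have "\<dots> = 1" using v by (simp add: r(2))
  finally have eq: "1 + (\<i> * t) * m + of_real v * m^2 = of_real v * (a * b)" by simp
  have "t / v \<le> (r + t) / (2 * v)" using r(1) v t by (simp add: field_simps)
  also have "\<dots> \<le> Im b" using m by (simp add: b_def \<beta>_def)
  also have "\<dots> \<le> norm b" using abs_Im_le_cmod[of b] by linarith
  finally have "v * (t / v) * norm a \<le> v * norm b * norm a"
    using v by (intro mult_right_mono mult_left_mono) auto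
  hence "t * norm a \<le> norm (1 + (\<i> * t) * m + of_real v * m^2)"
    unfolding eq norm_mult using v by (simp add: mult_ac)
  thus ?thesis using t by (simp add: a_def \<alpha>_def semicircle_stieltjes_def r_def field_simps)
qed

text \<open>
  The average of \<open>x^2 / (x^2 + t^2)\<close> over the eigenvalues \<open>x\<close>: a function of the resolvent whose
  integral over \<open>t\<close> is the mean absolute eigenvalue, up to the factor \<open>pi / 2\<close>.
\<close>
definition eig_profile :: "nat \<Rightarrow> real \<Rightarrow> (nat set \<Rightarrow> bool) \<Rightarrow> real \<Rightarrow> real" where
  "eig_profile n p f t = (\<Sum>k<n. eigval n (wigner n p f) k ^ 2 / (eigval n (wigner n p f) k ^ 2 + t^2)) / n"

lemma Im_stieltjes:
  assumes "t > 0" "n > 0"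
  shows "t * Im (stieltjes n p (\<i> * t) f) = 1 - eig_profile n p f t"
    and "Im (stieltjes n p (\<i> * t) f) \<ge> 0"
proof -
  define lam where "lam = eigval n (wigner n p f)"
  have "Im (1 / (complex_of_real x - \<i> * t)) = t / (x^2 + t^2)" for x
    by (simp add: Im_divide power2_eq_square)
  hence I: "Im (stieltjes n p (\<i> * t) f) = (\<Sum>k<n. t / (lam k ^ 2 + t^2)) / n"
    unfolding stieltjes_def by (simp add: resolvent_trace[OF wigner_sym] lam_def)
  have sq: "t * (t / (x^2 + t^2)) = 1 - x^2 / (x^2 + t^2)" for x :: real
  proof -
    have "x^2 + t^2 > 0" using assms by (intro add_nonneg_pos) auto
    hence "x^2 / (x^2 + t^2) + t^2 / (x^2 + t^2) = 1"
      using assms(1) by (simp flip: add_divide_distrib)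
    thus ?thesis by (simp add: power2_eq_square)
  qed
  have "t * (\<Sum>k<n. t / (lam k ^ 2 + t^2)) = n - (\<Sum>k<n. lam k ^ 2 / (lam k ^ 2 + t^2))"
    unfolding sum_distrib_left sq by (simp add: sum_subtractf)
  thus "t * Im (stieltjes n p (\<i> * t) f) = 1 - eig_profile n p f t"
    unfolding I eig_profile_def lam_def[symmetric] using assms by (simp add: field_simps)
  show "Im (stieltjes n p (\<i> * t) f) \<ge> 0"
    unfolding I using assms by (intro divide_nonneg_nonneg sum_nonneg) auto
qed

lemma eig_profile_integral:
  assumes "n > 0"
  shows "integrable half_line (eig_profile n p f)"
    and "integral\<^sup>L half_line (eig_profile n p f) = pi / 2 * ((\<Sum>k<n. \<bar>eigval n (wigner n p f) k\<bar>) / n)"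
  unfolding eig_profile_def[abs_def]
  by (simp_all add: abs_arctan_integral sum_distrib_left)

text \<open>
  Both sides are the squared Frobenius norm.
\<close>
lemma sum_eigval_sq:
  assumes "\<And>i j. i < n \<Longrightarrow> j < n \<Longrightarrow> A i j = A j i"
  shows "(\<Sum>k<n. eigval n A k ^ 2) = (\<Sum>i<n. \<Sum>j<n. A i j ^ 2)"
proof -
  define lam where "lam = eigval n A"
  define U where "U = eigvec n A"
  have e: "eigendecomp n A lam U" unfolding lam_def U_def by (rule eigendecomp_eigval) (rule assms)
  have "(\<Sum>j<n. A i j ^ 2) = (\<Sum>k<n. (lam k * U i k)^2)" if "i < n" for i
  proof -
    have "(\<Sum>j<n. A i j ^ 2) = (\<Sum>j<n. (\<Sum>k<n. U j k * (lam k * U i k))^2)"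
      using that by (intro sum.cong refl) (simp add: eigendecompD(3)[OF e] algebra_simps)
    also have "\<dots> = (\<Sum>k<n. (lam k * U i k)^2)"
      by (rule parseval) (rule eigendecompD(1)[OF e])
    finally show ?thesis .
  qed
  hence "(\<Sum>i<n. \<Sum>j<n. A i j ^ 2) = (\<Sum>i<n. \<Sum>k<n. (lam k * U i k)^2)"
    by simp
  also have "\<dots> = (\<Sum>k<n. \<Sum>i<n. (lam k * U i k)^2)"
    by (rule sum.swap)
  also have "\<dots> = (\<Sum>k<n. lam k ^ 2 * (\<Sum>i<n. U i k * U i k))"
    by (simp add: sum_distrib_left power2_eq_square algebra_simps)
  also have "\<dots> = (\<Sum>k<n. lam k ^ 2)"
    by (simp add: eigendecompD(1)[OF e])
  finally show ?thesis by (simp add: lam_def)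
qed

text \<open>
  The entries of the matrix have squares at most \<open>1 / n\<close>, so its eigenvalues have mean square at most
  one. With \<open>x^2 / (x^2 + t^2) * (1 + t^2) \<le> 1 + x^2\<close> this yields a bound that is integrable in \<open>t\<close>
  and independent of \<open>n\<close> and of the graph.
\<close>
lemma eig_profile_bound:
  assumes p: "0 \<le> p" "p \<le> 1" and t: "t > 0"
  shows "eig_profile n p f t \<ge> 0" "eig_profile n p f t \<le> 2 * (1 / (1 + t^2))"
proof -
  define lam where "lam = eigval n (wigner n p f)"
  show "eig_profile n p f t \<ge> 0"
    unfolding eig_profile_def by (intro divide_nonneg_nonneg sum_nonneg) auto
  show "eig_profile n p f t \<le> 2 * (1 / (1 + t^2))"
  proof (cases "n = 0")
    case True
    thus ?thesis by (simp add: eig_profile_def add_nonneg_nonneg)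
  next
    case False
    have "wigner n p f i j ^ 2 \<le> 1 / n" for i j
    proof -
      have "(of_bool (f {i, j}) - p)^2 \<le> 1" using p by (auto simp: power_le_one abs_square_le_1)
      thus ?thesis using False by (auto simp: wigner_def power_divide divide_right_mono)
    qed
    hence "(\<Sum>k<n. lam k ^ 2) \<le> (\<Sum>i<n. \<Sum>j<n. 1 / n)"
      unfolding lam_def by (subst sum_eigval_sq[OF wigner_sym]) (intro sum_mono, auto)
    hence sq: "(\<Sum>k<n. lam k ^ 2) \<le> n" using False by simp
    have "(1 + t^2) * (x^2 / (x^2 + t^2)) \<le> 1 + x^2" for x
    proof -
      have "x^2 + t^2 > 0" using t by (intro add_nonneg_pos) auto
      thus ?thesis by (simp add: field_simps)
    qed
    hence "(\<Sum>k<n. (1 + t^2) * (lam k ^ 2 / (lam k ^ 2 + t^2))) \<le> (\<Sum>k<n. 1 + lam k ^ 2)"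
      by (intro sum_mono)
    also have "\<dots> \<le> 2 * n" using sq by (simp add: sum.distrib)
    finally have "(1 + t^2) * (\<Sum>k<n. lam k ^ 2 / (lam k ^ 2 + t^2)) \<le> 2 * n"
      unfolding sum_distrib_left .
    hence "(1 + t^2) * (\<Sum>k<n. lam k ^ 2 / (lam k ^ 2 + t^2)) / n \<le> 2 * n / n"
      by (intro divide_right_mono) auto
    hence "(1 + t^2) * eig_profile n p f t \<le> 2"
      using False by (simp add: eig_profile_def lam_def)
    moreover have "1 + t^2 > 0" by (intro add_pos_nonneg) auto
    ultimately show ?thesis by (simp add: field_simps)
  qed
qed

lemma expect_abs_le_sqrt:
  fixes X :: "('a \<Rightarrow> bool) \<Rightarrow> real"
  assumes "finite A" "expect (coins A p) (\<lambda>f. X f ^ 2) \<le> v"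
  shows "expect (coins A p) X \<le> sqrt v"
proof -
  define m where "m = expect (coins A p) X"
  have "0 \<le> expect (coins A p) (\<lambda>f. (X f - m) ^ 2)" by simp
  also have "\<dots> = expect (coins A p) (\<lambda>f. X f ^ 2 - 2 * m * X f + m ^ 2)"
    by (simp add: power2_diff algebra_simps)
  also have "\<dots> = expect (coins A p) (\<lambda>f. X f ^ 2) - m ^ 2"
    using assms(1) by (simp add: m_def power2_eq_square)
  finally have "m ^ 2 \<le> v" using assms(2) by simp
  thus ?thesis unfolding m_def[symmetric] by (rule real_le_rsqrt)
qed

text \<open>
  The fluctuation of the Stieltjes transform around its mean gives the first term, and the distance of
  the mean from the semicircle value gives the second. For fixed \<open>t\<close> both tend to zero.
\<close>
lemma expect_profile_error_bound:
  assumes p: "0 < p" "p < 1" and t: "t > 0" and n: "n > 0"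
  shows "expect (coins (possible_edges n) p) (\<lambda>f. \<bar>eig_profile n p f t - (1 - t * semicircle_stieltjes (p * (1 - p)) t)\<bar>)
    \<le> t * (sqrt (4 / (n * t^4)) + (8 / (sqrt n * t^3) + 3 / (n * t^2) + 4 / (n * t^4)) / t)"
proof -
  define M where "M = coins (possible_edges n) p"
  define s where "s = stieltjes n p (\<i> * t)"
  define m where "m = expect M s"
  define y where "y = semicircle_stieltjes (p * (1 - p)) t"
  have int [simp]: "integrable (measure_pmf M) F" for F :: "_ \<Rightarrow> complex"
    unfolding M_def by simp
  have intr [simp]: "integrable (measure_pmf M) F" for F :: "_ \<Rightarrow> real"
    unfolding M_def by simp
  have v: "p * (1 - p) > 0" using p by simp
  have p': "0 \<le> p" "p \<le> 1" using p by auto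
  have "Im m = expect M (\<lambda>f. Im (s f))" unfolding m_def by (rule integral_Im[symmetric]) simp
  also have "\<dots> \<ge> 0" unfolding s_def by (intro Bochner_Integration.integral_nonneg Im_stieltjes(2) t n)
  finally have "norm (m - \<i> * y) \<le> norm (1 + (\<i> * t) * m + of_real (p * (1 - p)) * m^2) / t"
    unfolding y_def by (rule semicircle_equation_stable[OF v t])
  also have "\<dots> \<le> (8 / (sqrt n * t^3) + 3 / (n * t^2) + 4 / (n * t^4)) / t"
    using stieltjes_fixed_point_expect[OF p' _ n, of "\<i> * t"] t
    by (intro divide_right_mono) (auto simp: m_def M_def s_def)
  finally have B: "norm (m - \<i> * y) \<le> (8 / (sqrt n * t^3) + 3 / (n * t^2) + 4 / (n * t^4)) / t" .
  have V: "expect M (\<lambda>f. norm (s f - m)) \<le> sqrt (4 / (n * t^4))"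
    unfolding M_def using stieltjes_variance[OF p', of "\<i> * t" n] t
    by (intro expect_abs_le_sqrt) (auto simp: m_def M_def s_def)
  have "expect M (\<lambda>f. \<bar>eig_profile n p f t - (1 - t * y)\<bar>) \<le> expect M (\<lambda>f. t * (norm (s f - m) + norm (m - \<i> * y)))"
  proof (intro integral_mono)
    fix f
    have "eig_profile n p f t - (1 - t * y) = - (t * Im (s f - \<i> * y))"
      using Im_stieltjes(1)[OF t n, of p f] by (simp add: s_def algebra_simps)
    hence "\<bar>eig_profile n p f t - (1 - t * y)\<bar> = t * \<bar>Im (s f - \<i> * y)\<bar>"
      using t by (simp only: abs_minus_cancel abs_mult abs_of_pos)
    also have "\<bar>Im (s f - \<i> * y)\<bar> \<le> norm (s f - \<i> * y)" by (rule abs_Im_le_cmod)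
    also have "norm (s f - \<i> * y) \<le> norm (s f - m) + norm (m - \<i> * y)"
      using norm_triangle_ineq[of "s f - m" "m - \<i> * y"] by simp
    finally show "\<bar>eig_profile n p f t - (1 - t * y)\<bar> \<le> t * (norm (s f - m) + norm (m - \<i> * y))"
      using t by simp
  qed simp_all
  also have "\<dots> = t * (expect M (\<lambda>f. norm (s f - m)) + norm (m - \<i> * y))"
    by simp
  also have "\<dots> \<le> t * (sqrt (4 / (n * t^4)) + (8 / (sqrt n * t^3) + 3 / (n * t^2) + 4 / (n * t^4)) / t)"
    using t by (intro mult_left_mono add_mono V B) auto
  finally show ?thesis by (simp add: M_def y_def)
qed

text \<open>
  Integrate the error of the profile over \<open>t\<close>. The expectation is a finite sum over graphs and may be
  exchanged with the integral; dominated convergence then applies.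
\<close>
theorem mean_abs_eigenvalue_limit:
  assumes p: "0 < p" "p < 1"
  shows "(\<lambda>n. expect (coins (possible_edges n) p)
      (\<lambda>f. \<bar>(\<Sum>k<n. \<bar>eigval n (wigner n p f) k\<bar>) / n - 8 / (3 * pi) * sqrt (p * (1 - p))\<bar>)) \<longlonglongrightarrow> 0"
proof -
  define v where "v = p * (1 - p)"
  have v: "v > 0" using p by (simp add: v_def)
  define h where "h t = 1 - t * semicircle_stieltjes v t" for t
  define M where "M n = coins (possible_edges n) p" for n
  define D where "D n t = expect (M n) (\<lambda>f. \<bar>eig_profile n p f t - h t\<bar>)" for n t
  define X where "X n f = (\<Sum>k<n. \<bar>eigval n (wigner n p f) k\<bar>) / n" for n f
  note h = semicircle_profile_integral[OF v, folded h_def]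
  have w_int: "integrable half_line (\<lambda>t. 2 * (1 / (1 + t^2)) + h t)"
    using abs_arctan_integral(1)[of 1] h(1)
    by (intro Bochner_Integration.integrable_add integrable_mult_right) simp_all
  have D_sum: "D n t = (\<Sum>f\<in>set_pmf (M n). \<bar>eig_profile n p f t - h t\<bar> * pmf (M n) f)" for n t
    unfolding D_def by (rule integral_measure_pmf_real) (auto simp: M_def finite_set_pmf_coins)
  have int_diff: "integrable half_line (\<lambda>t. \<bar>eig_profile n p f t - h t\<bar>)" if "n > 0" for n f
    using eig_profile_integral(1)[OF that] h(1) by simp
  have D_int: "integrable half_line (D n)" if "n > 0" for n
    unfolding D_sum[abs_def] using int_diff[OF that] by simp
  \<comment> \<open>The shift by one avoids \<open>n = 0\<close>, where the average over the eigenvalues is no average.\<close>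
  have "(\<lambda>n. integral\<^sup>L half_line (D (Suc n))) \<longlonglongrightarrow> integral\<^sup>L half_line (\<lambda>t. 0)"
  proof (rule integral_dominated_convergence[OF _ _ w_int])
    show "AE t in half_line. (\<lambda>n. D (Suc n) t) \<longlonglongrightarrow> 0"
    proof (rule AE_I2)
      fix t assume "t \<in> space half_line"
      hence t: "t > 0" by simp
      have *: "D (Suc n) t \<le> t * (sqrt (4 / (Suc n * t^4)) + (8 / (sqrt (Suc n) * t^3) + 3 / (Suc n * t^2) + 4 / (Suc n * t^4)) / t)" for n
        unfolding D_def h_def v_def M_def by (rule expect_profile_error_bound[OF p t]) simp
      show "(\<lambda>n. D (Suc n) t) \<longlonglongrightarrow> 0"
      proof (rule tendsto_sandwich[OF _ _ tendsto_const])
        show "(\<lambda>n. t * (sqrt (4 / (Suc n * t^4)) + (8 / (sqrt (Suc n) * t^3) + 3 / (Suc n * t^2) + 4 / (Suc n * t^4)) / t)) \<longlonglongrightarrow> 0"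
          using t by real_asymp
        show "\<forall>\<^sub>F n in sequentially. 0 \<le> D (Suc n) t" by (simp add: D_def)
      qed (use * in simp)
    qed
    show "AE t in half_line. norm (D (Suc n) t) \<le> 2 * (1 / (1 + t^2)) + h t" for n
    proof (rule AE_I2)
      fix t assume "t \<in> space half_line"
      hence t: "t > 0" by simp
      have "\<bar>eig_profile (Suc n) p f t - h t\<bar> \<le> 2 * (1 / (1 + t^2)) + h t" for f
        using eig_profile_bound[of p t "Suc n" f] h(3)[OF t] p t by simp
      hence "D (Suc n) t \<le> 2 * (1 / (1 + t^2)) + h t"
        unfolding D_def by (intro measure_pmf.integral_le_const) (auto simp: M_def)
      moreover have "D (Suc n) t \<ge> 0" by (simp add: D_def)
      ultimately show "norm (D (Suc n) t) \<le> 2 * (1 / (1 + t^2)) + h t" by simp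
    qed
  qed (use D_int in auto)
  hence lim: "(\<lambda>n. 2 / pi * integral\<^sup>L half_line (D (Suc n))) \<longlonglongrightarrow> 0"
    by (auto intro!: tendsto_eq_intros)
  have bound: "expect (M n) (\<lambda>f. \<bar>X n f - 8 / (3 * pi) * sqrt v\<bar>) \<le> 2 / pi * integral\<^sup>L half_line (D n)"
    if n: "n > 0" for n
  proof -
    have "\<bar>X n f - 8 / (3 * pi) * sqrt v\<bar> \<le> 2 / pi * integral\<^sup>L half_line (\<lambda>t. \<bar>eig_profile n p f t - h t\<bar>)" for f
    proof -
      have "X n f - 8 / (3 * pi) * sqrt v = 2 / pi * (integral\<^sup>L half_line (eig_profile n p f) - integral\<^sup>L half_line h)"
        using h(2) by (simp add: X_def eig_profile_integral(2)[OF n] h_def[abs_def] field_simps)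
      also have "integral\<^sup>L half_line (eig_profile n p f) - integral\<^sup>L half_line h
          = integral\<^sup>L half_line (\<lambda>t. eig_profile n p f t - h t)"
        using eig_profile_integral(1)[OF n] h(1) by simp
      also have "\<bar>2 / pi * \<dots>\<bar> \<le> 2 / pi * integral\<^sup>L half_line (\<lambda>t. \<bar>eig_profile n p f t - h t\<bar>)"
        using integral_abs_bound[of half_line "\<lambda>t. eig_profile n p f t - h t"]
        by (simp add: abs_mult divide_right_mono)
      finally show ?thesis .
    qed
    hence "expect (M n) (\<lambda>f. \<bar>X n f - 8 / (3 * pi) * sqrt v\<bar>)
        \<le> expect (M n) (\<lambda>f. 2 / pi * integral\<^sup>L half_line (\<lambda>t. \<bar>eig_profile n p f t - h t\<bar>))"
      by (intro integral_mono) (auto simp: M_def)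
    also have "\<dots> = 2 / pi * (\<Sum>f\<in>set_pmf (M n). integral\<^sup>L half_line (\<lambda>t. \<bar>eig_profile n p f t - h t\<bar>) * pmf (M n) f)"
      by (subst integral_measure_pmf_real[where A = "set_pmf (M n)"])
         (auto simp: M_def finite_set_pmf_coins sum_distrib_left mult.assoc)
    also have "(\<Sum>f\<in>set_pmf (M n). integral\<^sup>L half_line (\<lambda>t. \<bar>eig_profile n p f t - h t\<bar>) * pmf (M n) f)
        = integral\<^sup>L half_line (D n)"
      unfolding D_sum[abs_def] using int_diff[OF n] by simp
    finally show ?thesis .
  qed
  have "(\<lambda>n. expect (M (Suc n)) (\<lambda>f. \<bar>X (Suc n) f - 8 / (3 * pi) * sqrt v\<bar>)) \<longlonglongrightarrow> 0"
  proof (rule tendsto_sandwich[OF _ _ tendsto_const lim])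
    show "\<forall>\<^sub>F n in sequentially. expect (M (Suc n)) (\<lambda>f. \<bar>X (Suc n) f - 8 / (3 * pi) * sqrt v\<bar>)
       \<le> 2 / pi * integral\<^sup>L half_line (D (Suc n))"
      using bound by (intro always_eventually allI) simp
  qed simp
  hence "(\<lambda>n. expect (M n) (\<lambda>f. \<bar>X n f - 8 / (3 * pi) * sqrt v\<bar>)) \<longlonglongrightarrow> 0"
    by (subst (asm) filterlim_sequentially_Suc)
  thus ?thesis by (simp add: M_def X_def v_def)
qed

section \<open>The energy of the distance matrix\<close>

text \<open>
  The distance matrix is \<open>(2 - p) (J - I) - sqrt n W\<close>, where \<open>W\<close> is \<open>wigner\<close>. Solving for either of
  the two matrices and applying \<open>sum_abs_eigenvalues_le\<close> gives the two sides of the estimate.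
\<close>
lemma energy_dist_matrix_coin_graph:
  assumes good: "common_neighbours n f" and p: "0 < p" "p < 1" and n: "n > 0"
  shows "\<bar>energy (dist_matrix n (coin_graph n f)) - sqrt n * (\<Sum>k<n. \<bar>eigval n (wigner n p f) k\<bar>)\<bar> \<le> 4 * n"
proof -
  define A where "A i j = graph_dist (coin_graph n f) i j" for i j
  define W where "W = wigner n p f"
  have A: "A i j = (2 - p) + - (2 - p) * of_bool (i = j) + - sqrt n * W i j" if "i < n" "j < n" for i j
    using that n by (simp add: A_def graph_dist_coin_graph[OF good] W_def wigner_def)
  have W: "W i j = (2 - p) / sqrt n + - ((2 - p) / sqrt n) * of_bool (i = j) + - (1 / sqrt n) * A i j"
    if "i < n" "j < n" for i j
    using that n by (simp add: A field_simps)
  have "A i j = A j i" if "i < n" "j < n" for i j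
    using A[OF that] A[OF that(2,1)] wigner_sym[of n p f i j] by (cases "i = j") (auto simp: W_def)
  then obtain lam U where lam: "eigendecomp n A lam U"
    using eigendecomp_exists[of n A] by blast
  have mu: "eigendecomp n W (eigval n W) (eigvec n W)"
    unfolding W_def by (intro eigendecomp_eigval wigner_sym)
  have E: "energy (dist_matrix n (coin_graph n f)) = (\<Sum>k<n. \<bar>lam k\<bar>)"
    using energy_eq_sum_abs[OF lam] by (simp add: dist_matrix_def A_def)
  have "(\<Sum>k<n. \<bar>lam k\<bar>) \<le> (\<bar>2 - p\<bar> + \<bar>- (2 - p)\<bar>) * n + \<bar>- sqrt n\<bar> * (\<Sum>k<n. \<bar>eigval n W k\<bar>)"
    by (rule sum_abs_eigenvalues_le[OF lam mu A])
  also have "\<dots> = 2 * (2 - p) * n + sqrt n * (\<Sum>k<n. \<bar>eigval n W k\<bar>)"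
    using p by simp
  finally have 1: "(\<Sum>k<n. \<bar>lam k\<bar>) \<le> 2 * (2 - p) * n + sqrt n * (\<Sum>k<n. \<bar>eigval n W k\<bar>)" .
  have "(\<Sum>k<n. \<bar>eigval n W k\<bar>) \<le> (\<bar>(2 - p) / sqrt n\<bar> + \<bar>- ((2 - p) / sqrt n)\<bar>) * n + \<bar>- (1 / sqrt n)\<bar> * (\<Sum>k<n. \<bar>lam k\<bar>)"
    by (rule sum_abs_eigenvalues_le[OF mu lam W])
  also have "\<dots> = (2 * (2 - p) * n + (\<Sum>k<n. \<bar>lam k\<bar>)) / sqrt n"
    using p by (simp add: abs_divide add_divide_distrib)
  finally have 2: "sqrt n * (\<Sum>k<n. \<bar>eigval n W k\<bar>) \<le> 2 * (2 - p) * n + (\<Sum>k<n. \<bar>lam k\<bar>)"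
    using n by (simp add: field_simps)
  have "2 * (2 - p) * n \<le> 4 * n" using p mult_right_mono[of "2 * (2 - p)" 4 "real n"] by simp
  thus ?thesis using 1 2 unfolding E W_def by linarith
qed

lemma no_common_neighbour_bound_tendsto_0:
  assumes p: "0 < p" "p < 1"
  shows "(\<lambda>n. real n ^ 2 * (1 - p ^ 2) ^ (n - 2)) \<longlonglongrightarrow> 0"
proof -
  define q where "q = 1 - p ^ 2"
  have q: "0 < q" "q < 1" using p by (auto simp: q_def power_less_one_iff)
  have "(\<lambda>n. real (n + 2) ^ 2 * q ^ n) \<longlonglongrightarrow> 0"
    using q by real_asymp
  hence "(\<lambda>n. real (n + 2) ^ 2 * q ^ (n + 2 - 2)) \<longlonglongrightarrow> 0" by simp
  from LIMSEQ_offset[OF this] show ?thesis unfolding q_def .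
qed

lemma prob_deviation_le:
  fixes X :: "('a \<Rightarrow> bool) \<Rightarrow> real"
  assumes "finite A" "r > 0" "\<And>f. X f \<ge> 0" "expect (coins A p) X \<le> r ^ 2"
  shows "measure_pmf.prob (coins A p) {f. X f > r} \<le> r"
proof -
  have "r * measure_pmf.prob (coins A p) {f. X f > r} = expect (coins A p) (\<lambda>f. r * indicator {f. X f > r} f)"
    by simp
  also have "\<dots> \<le> expect (coins A p) X"
    using assms by (intro integral_mono) (auto simp: indicator_def)
  also have "\<dots> \<le> r * r" using assms(4) by (simp add: power2_eq_square)
  finally show ?thesis using assms(2) by simp
qed

theorem corollary3p1:
  fixes p :: real
  assumes "0 < p" and "p < 1"
  shows "\<exists>\<epsilon> :: nat \<Rightarrow> real. \<epsilon> \<longlonglongrightarrow> 0 \<and>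
    (\<lambda>n. measure_pmf.prob (gnp n p)
       {G. \<exists>\<delta> :: real. \<bar>\<delta>\<bar> \<le> \<epsilon> n \<and>
             energy (dist_matrix n G) =
               (8 / (3 * pi) * sqrt (p * (1 - p)) + \<delta>) * real n powr (3 / 2)})
    \<longlonglongrightarrow> 1"
proof -
  define c where "c = 8 / (3 * pi) * sqrt (p * (1 - p))"
  define M where "M n = coins (possible_edges n) p" for n
  define X where "X n f = \<bar>(\<Sum>k<n. \<bar>eigval n (wigner n p f) k\<bar>) / n - c\<bar>" for n f
  define a where "a n = expect (M n) (X n)" for n
  \<comment> \<open>By Markov's inequality a deviation of more than \<open>r n\<close> has probability at most \<open>a n / r n \<le> r n\<close>; the summand \<open>1 / (n + 1)\<close> keeps \<open>r n\<close> positive.\<close>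
  define r where "r n = sqrt (a n + 1 / (real n + 1))" for n
  \<comment> \<open>The second term is the error \<open>4 n\<close> of \<open>energy_dist_matrix_coin_graph\<close> divided by \<open>n powr (3/2)\<close>.\<close>
  define \<epsilon> where "\<epsilon> n = r n + 4 / sqrt n" for n
  define T where "T n = {G. \<exists>\<delta> :: real. \<bar>\<delta>\<bar> \<le> \<epsilon> n \<and>
     energy (dist_matrix n G) = (c + \<delta>) * real n powr (3 / 2)}" for n
  have a0: "a n \<ge> 0" for n by (simp add: a_def X_def)
  have r_pos: "r n > 0" for n using a0[of n] by (simp add: r_def add_nonneg_pos)
  have r_sq: "a n \<le> r n ^ 2" for n using a0[of n] by (simp add: r_def add_nonneg_nonneg)
  have a_lim: "a \<longlonglongrightarrow> 0"
    using mean_abs_eigenvalue_limit[OF assms] by (simp add: a_def[abs_def] X_def[abs_def] M_def c_def)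
  have r_lim: "r \<longlonglongrightarrow> 0"
  proof -
    have "(\<lambda>n. 1 / (real n + 1)) \<longlonglongrightarrow> 0" by real_asymp
    hence "(\<lambda>n. sqrt (a n + 1 / (real n + 1))) \<longlonglongrightarrow> sqrt (0 + 0)"
      by (intro tendsto_intros a_lim)
    thus ?thesis by (simp add: r_def[abs_def])
  qed
  have \<epsilon>_lim: "\<epsilon> \<longlonglongrightarrow> 0"
  proof -
    have "(\<lambda>n. 4 / sqrt (real n)) \<longlonglongrightarrow> 0" by real_asymp
    from tendsto_add[OF r_lim this] show ?thesis by (simp add: \<epsilon>_def[abs_def])
  qed
  have in_T: "coin_graph n f \<in> T n" if n: "n > 0" and f: "common_neighbours n f" "X n f \<le> r n" for n f
  proof -
    define N where "N = real n powr (3 / 2)"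
    have N: "N = n * sqrt n"
      using n powr_add[of "real n" 1 "1/2"] by (simp add: N_def powr_half_sqrt)
    have N_pos: "N > 0" using n by (simp add: N)
    define S where "S = (\<Sum>k<n. \<bar>eigval n (wigner n p f) k\<bar>)"
    define E where "E = energy (dist_matrix n (coin_graph n f))"
    have "\<bar>E / N - S / n\<bar> = \<bar>E - sqrt n * S\<bar> / N"
    proof -
      have "S / n = sqrt n * S / N" using n by (simp add: N)
      thus ?thesis using N_pos by (simp add: abs_divide flip: diff_divide_distrib)
    qed
    also have "\<dots> \<le> 4 * n / N"
      unfolding E_def S_def using N_pos n assms
      by (intro divide_right_mono energy_dist_matrix_coin_graph f) auto
    also have "\<dots> = 4 / sqrt n" using n by (simp add: N)
    finally have "\<bar>E / N - c\<bar> \<le> \<epsilon> n"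
      using f(2) unfolding X_def S_def[symmetric] \<epsilon>_def by linarith
    moreover have "E = (c + (E / N - c)) * N" using N_pos by simp
    ultimately show ?thesis unfolding T_def E_def N_def by blast
  qed
  have lower: "1 - (real n ^ 2 * (1 - p ^ 2) ^ (n - 2) + r n) \<le> measure_pmf.prob (gnp n p) (T n)" if n: "n > 0" for n
  proof -
    let ?B = "{f. \<not> common_neighbours n f}" and ?C = "{f. X n f > r n}"
    have "- (coin_graph n -` T n) \<subseteq> ?B \<union> ?C"
      using in_T[OF n] by (auto simp: not_le[symmetric])
    hence "measure_pmf.prob (M n) (- (coin_graph n -` T n)) \<le> measure_pmf.prob (M n) (?B \<union> ?C)"
      by (intro measure_pmf.finite_measure_mono) auto
    also have "\<dots> \<le> measure_pmf.prob (M n) ?B + measure_pmf.prob (M n) ?C"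
      by (intro measure_Un_le) auto
    also have "\<dots> \<le> real n ^ 2 * (1 - p ^ 2) ^ (n - 2) + r n"
      unfolding M_def
    proof (intro add_mono prob_common_neighbours prob_deviation_le)
      show "expect (coins (possible_edges n) p) (X n) \<le> (r n)\<^sup>2"
        using r_sq[of n] by (simp add: a_def M_def)
    qed (use assms r_pos in \<open>auto simp: X_def\<close>)
    also have "measure_pmf.prob (M n) (- (coin_graph n -` T n)) = 1 - measure_pmf.prob (M n) (coin_graph n -` T n)"
      using measure_pmf.prob_compl[of "coin_graph n -` T n" "M n"] by (simp add: Compl_eq_Diff_UNIV)
    also have "measure_pmf.prob (M n) (coin_graph n -` T n) = measure_pmf.prob (gnp n p) (T n)"
      by (simp add: gnp_eq M_def)
    finally show ?thesis by linarith
  qed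
  have "(\<lambda>n. measure_pmf.prob (gnp n p) (T n)) \<longlonglongrightarrow> 1"
  proof (rule tendsto_sandwich)
    show "\<forall>\<^sub>F n in sequentially. 1 - (real n ^ 2 * (1 - p ^ 2) ^ (n - 2) + r n) \<le> measure_pmf.prob (gnp n p) (T n)"
      using eventually_gt_at_top[of 0] by eventually_elim (rule lower)
    show "\<forall>\<^sub>F n in sequentially. measure_pmf.prob (gnp n p) (T n) \<le> 1"
      by simp
    have "(\<lambda>n. 1 - (real n ^ 2 * (1 - p ^ 2) ^ (n - 2) + r n)) \<longlonglongrightarrow> 1 - (0 + 0)"
      by (intro tendsto_intros no_common_neighbour_bound_tendsto_0 assms r_lim)
    thus "(\<lambda>n. 1 - (real n ^ 2 * (1 - p ^ 2) ^ (n - 2) + r n)) \<longlonglongrightarrow> 1" by simp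
  qed simp
  with \<epsilon>_lim show ?thesis unfolding T_def c_def by blast
qed

end
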